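(* The category $\mathbf{StoneMT}$ of Stone MT-algebras and MT-morphisms is equivalent to the category $\mathbf{StoneFrm}$ of Stone frames and frame homomorphisms, and dually equivalent to the category $\mathbf{Stone}$ of Stone spaces and continuous maps.
   Context: An MT-algebra is a pair $M=(B,\square)$ where $B$ is a complete boolean algebra and $\square:B\to B$ satisfies $\square 1=1$, $\square(a\wedge b)=\square a\wedge\square b$, $\square a\le a$, $\square a\le\square\square a$. An MT-morphism $f:M\to N$ is a complete boolean homomorphism with $f(\square_M a)\le\square_N f(a)$ for all $a$. Put $\diamond a=\neg\square\neg a$. An element $a$ is open if $a=\square a$, closed if $a=\diamond a$, clopen if both; $\mathrm{O}(M)$ is the set of open elements and $\mathrm{clp}(M)$ the set of clopen elements. $M$ is a $T_1$-algebra if every element is a join of closed elements. $M$ is Hausdorff if every element of $M$ is a join of elements of $\mathrm{AC}(M)=\{a\in M\mid a=\bigwedge\{\diamond\square c\mid c\in M,\ a\le\square c\}\}$. $M$ is zero-dimensional if it is a $T_1$-algebra and $a=\bigvee\{b\in\mathrm{clp}(M)\mid b\le a\}$ for every $a\in\mathrm{O}(M)$. $M$ is compact if for each $S\subseteq\mathrm{O}(M)$ with $\bigvee S=1$ there is a finite $T\subseteq S$ with $\bigvee T=1$. A Stone MT-algebra is a compact Hausdorff zero-dimensional MT-algebra. A frame is a complete lattice in which finite meets distribute over arbitrary joins; frame homomorphisms preserve finite meets and arbitrary joins. An element $c$ of a frame $L$ is complemented if $c\vee c^*=1$, where $c^*$ is its pseudocomplement. $L$ is zero-dimensional if every $a\in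 L$ is the join of the complemented elements below it, and compact if $\bigvee S=1$ implies $\bigvee T=1$ for some finite $T\subseteq S$. A Stone frame is a compact zero-dimensional frame. A Stone space is a compact Hausdorff space whose clopen sets form a basis. *)

theory Defs
  imports "HOL-Analysis.Analysis" "HOL-Algebra.Complete_Lattice"
begin

section \<open>Categories, functors, equivalence\<close>

text \<open>Hom-sets are indexed by source and target and need not be disjoint; accordingly
  composition and the arrow part of a functor take the objects as arguments.
  \<open>Cmp C a b c g f\<close> is the composite of \<open>f : a \<rightarrow> b\<close> followed by \<open>g : b \<rightarrow> c\<close>.\<close>

record ('o, 'm) cat =
  Obj :: "'o set"
  Hom :: "'o \<Rightarrow> 'o \<Rightarrow> 'm set"
  Idn :: "'o \<Rightarrow> 'm"
  Cmp :: "'o \<Rightarrow> 'o \<Rightarrow> 'o \<Rightarrow> 'm \<Rightarrow> 'm \<Rightarrow> 'm"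

definition is_category :: "('o, 'm) cat \<Rightarrow> bool" where
  "is_category C \<longleftrightarrow>
     (\<forall>a\<in>Obj C. Idn C a \<in> Hom C a a) \<and>
     (\<forall>a\<in>Obj C. \<forall>b\<in>Obj C. \<forall>c\<in>Obj C. \<forall>f\<in>Hom C a b. \<forall>g\<in>Hom C b c.
        Cmp C a b c g f \<in> Hom C a c) \<and>
     (\<forall>a\<in>Obj C. \<forall>b\<in>Obj C. \<forall>f\<in>Hom C a b.
        Cmp C a a b f (Idn C a) = f \<and> Cmp C a b b (Idn C b) f = f) \<and>
     (\<forall>a\<in>Obj C. \<forall>b\<in>Obj C. \<forall>c\<in>Obj C. \<forall>d\<in>Obj C.
        \<forall>f\<in>Hom C a b. \<forall>g\<in>Hom C b c. \<forall>h\<in>Hom C c d.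
        Cmp C a c d h (Cmp C a b c g f) = Cmp C a b d (Cmp C b c d h g) f)"

definition op_cat :: "('o, 'm) cat \<Rightarrow> ('o, 'm) cat" where
  "op_cat C = \<lparr>Obj = Obj C, Hom = (\<lambda>a b. Hom C b a), Idn = Idn C,
               Cmp = (\<lambda>a b c g f. Cmp C c b a f g)\<rparr>"

definition full_subcat :: "('o, 'm) cat \<Rightarrow> ('o \<Rightarrow> bool) \<Rightarrow> ('o, 'm) cat" where
  "full_subcat C P = C\<lparr>Obj := {a \<in> Obj C. P a}\<rparr>"

definition is_functor ::
  "('o, 'm) cat \<Rightarrow> ('p, 'n) cat \<Rightarrow> ('o \<Rightarrow> 'p) \<Rightarrow> ('o \<Rightarrow> 'o \<Rightarrow> 'm \<Rightarrow> 'n) \<Rightarrow> bool" where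
  "is_functor C D Fo Fa \<longleftrightarrow>
     (\<forall>a\<in>Obj C. Fo a \<in> Obj D) \<and>
     (\<forall>a\<in>Obj C. \<forall>b\<in>Obj C. \<forall>f\<in>Hom C a b. Fa a b f \<in> Hom D (Fo a) (Fo b)) \<and>
     (\<forall>a\<in>Obj C. Fa a a (Idn C a) = Idn D (Fo a)) \<and>
     (\<forall>a\<in>Obj C. \<forall>b\<in>Obj C. \<forall>c\<in>Obj C. \<forall>f\<in>Hom C a b. \<forall>g\<in>Hom C b c.
        Fa a c (Cmp C a b c g f) = Cmp D (Fo a) (Fo b) (Fo c) (Fa b c g) (Fa a b f))"

definition is_iso :: "('o, 'm) cat \<Rightarrow> 'o \<Rightarrow> 'o \<Rightarrow> 'm \<Rightarrow> bool" where
  "is_iso C a b f \<longleftrightarrow> f \<in> Hom C a b \<and>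
     (\<exists>g\<in>Hom C b a. Cmp C a b a g f = Idn C a \<and> Cmp C b a b f g = Idn C b)"

definition natural_iso ::
  "('o, 'm) cat \<Rightarrow> ('p, 'n) cat \<Rightarrow> ('o \<Rightarrow> 'p) \<Rightarrow> ('o \<Rightarrow> 'o \<Rightarrow> 'm \<Rightarrow> 'n) \<Rightarrow>
   ('o \<Rightarrow> 'p) \<Rightarrow> ('o \<Rightarrow> 'o \<Rightarrow> 'm \<Rightarrow> 'n) \<Rightarrow> ('o \<Rightarrow> 'n) \<Rightarrow> bool" where
  "natural_iso C D Fo Fa Go Ga \<eta> \<longleftrightarrow>
     (\<forall>a\<in>Obj C. is_iso D (Fo a) (Go a) (\<eta> a)) \<and>
     (\<forall>a\<in>Obj C. \<forall>b\<in>Obj C. \<forall>f\<in>Hom C a b.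
        Cmp D (Fo a) (Fo b) (Go b) (\<eta> b) (Fa a b f) =
        Cmp D (Fo a) (Go a) (Go b) (Ga a b f) (\<eta> a))"

definition equivalent :: "('o, 'm) cat \<Rightarrow> ('p, 'n) cat \<Rightarrow> bool" where
  "equivalent C D \<longleftrightarrow> is_category C \<and> is_category D \<and>
     (\<exists>Fo Fa Go Ga \<eta> \<epsilon>.
        is_functor C D Fo Fa \<and> is_functor D C Go Ga \<and>
        natural_iso C C (\<lambda>a. a) (\<lambda>a b f. f) (\<lambda>a. Go (Fo a)) (\<lambda>a b f. Ga (Fo a) (Fo b) (Fa a b f)) \<eta> \<and>
        natural_iso D D (\<lambda>a. Fo (Go a)) (\<lambda>a b f. Fa (Go a) (Go b) (Ga a b f)) (\<lambda>a. a) (\<lambda>a b f. f) \<epsilon>)"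

definition dually_equivalent :: "('o, 'm) cat \<Rightarrow> ('p, 'n) cat \<Rightarrow> bool" where
  "dually_equivalent C D \<longleftrightarrow> equivalent C (op_cat D)"


section \<open>MT-algebras\<close>

definition complete_boolean :: "('a, 'e) gorder_scheme \<Rightarrow> bool" where
  "complete_boolean L \<longleftrightarrow> complete_lattice L \<and>
     (\<forall>x\<in>carrier L. \<forall>y\<in>carrier L. \<forall>z\<in>carrier L.
        x \<sqinter>\<^bsub>L\<^esub> (y \<squnion>\<^bsub>L\<^esub> z) = (x \<sqinter>\<^bsub>L\<^esub> y) \<squnion>\<^bsub>L\<^esub> (x \<sqinter>\<^bsub>L\<^esub> z)) \<and>
     (\<forall>x\<in>carrier L. \<exists>y\<in>carrier L. x \<sqinter>\<^bsub>L\<^esub> y = \<bottom>\<^bsub>L\<^esub> \<and> x \<squnion>\<^bsub>L\<^esub> y = \<top>\<^bsub>L\<^esub>)"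

definition neg :: "('a, 'e) gorder_scheme \<Rightarrow> 'a \<Rightarrow> 'a" where
  "neg L x = (THE y. y \<in> carrier L \<and> x \<sqinter>\<^bsub>L\<^esub> y = \<bottom>\<^bsub>L\<^esub> \<and> x \<squnion>\<^bsub>L\<^esub> y = \<top>\<^bsub>L\<^esub>)"

record 'a mt = "'a gorder" +
  Box :: "'a \<Rightarrow> 'a"

definition mt_algebra :: "'a mt \<Rightarrow> bool" where
  "mt_algebra M \<longleftrightarrow> complete_boolean M \<and>
     Box M \<in> carrier M \<rightarrow> carrier M \<and>
     Box M \<top>\<^bsub>M\<^esub> = \<top>\<^bsub>M\<^esub> \<and>
     (\<forall>a\<in>carrier M. \<forall>b\<in>carrier M. Box M (a \<sqinter>\<^bsub>M\<^esub> b) = Box M a \<sqinter>\<^bsub>M\<^esub> Box M b) \<and>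
     (\<forall>a\<in>carrier M. Box M a \<sqsubseteq>\<^bsub>M\<^esub> a) \<and>
     (\<forall>a\<in>carrier M. Box M a \<sqsubseteq>\<^bsub>M\<^esub> Box M (Box M a))"

definition Dia :: "'a mt \<Rightarrow> 'a \<Rightarrow> 'a" where
  "Dia M a = neg M (Box M (neg M a))"

definition mt_opens :: "'a mt \<Rightarrow> 'a set" where
  "mt_opens M = {a \<in> carrier M. a = Box M a}"

definition mt_closeds :: "'a mt \<Rightarrow> 'a set" where
  "mt_closeds M = {a \<in> carrier M. a = Dia M a}"

definition mt_clopens :: "'a mt \<Rightarrow> 'a set" where
  "mt_clopens M = mt_opens M \<inter> mt_closeds M"

definition mt_T1 :: "'a mt \<Rightarrow> bool" where
  "mt_T1 M \<longleftrightarrow> (\<forall>a\<in>carrier M. \<exists>S \<subseteq> mt_closeds M. a = \<Squnion>\<^bsub>M\<^esub>S)"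

definition mt_AC :: "'a mt \<Rightarrow> 'a set" where
  "mt_AC M = {a \<in> carrier M.
     a = \<Sqinter>\<^bsub>M\<^esub>{Dia M (Box M c) | c. c \<in> carrier M \<and> a \<sqsubseteq>\<^bsub>M\<^esub> Box M c}}"

definition mt_Hausdorff :: "'a mt \<Rightarrow> bool" where
  "mt_Hausdorff M \<longleftrightarrow> (\<forall>a\<in>carrier M. \<exists>S \<subseteq> mt_AC M. a = \<Squnion>\<^bsub>M\<^esub>S)"

definition mt_zero_dimensional :: "'a mt \<Rightarrow> bool" where
  "mt_zero_dimensional M \<longleftrightarrow> mt_T1 M \<and>
     (\<forall>a\<in>mt_opens M. a = \<Squnion>\<^bsub>M\<^esub>{b \<in> mt_clopens M. b \<sqsubseteq>\<^bsub>M\<^esub> a})"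

definition mt_compact :: "'a mt \<Rightarrow> bool" where
  "mt_compact M \<longleftrightarrow>
     (\<forall>S \<subseteq> mt_opens M. \<Squnion>\<^bsub>M\<^esub>S = \<top>\<^bsub>M\<^esub> \<longrightarrow> (\<exists>T \<subseteq> S. finite T \<and> \<Squnion>\<^bsub>M\<^esub>T = \<top>\<^bsub>M\<^esub>))"

definition stone_mt :: "'a mt \<Rightarrow> bool" where
  "stone_mt M \<longleftrightarrow> mt_algebra M \<and> mt_compact M \<and> mt_Hausdorff M \<and> mt_zero_dimensional M"

text \<open>Morphisms are extensional (\<open>undefined\<close> off the carrier), so that equality of HOL functions
  is equality of maps between carriers.\<close>

definition mt_hom :: "'a mt \<Rightarrow> 'b mt \<Rightarrow> ('a \<Rightarrow> 'b) set" where
  "mt_hom M N = {f \<in> carrier M \<rightarrow>\<^sub>E carrier N.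
     (\<forall>S \<subseteq> carrier M. f (\<Squnion>\<^bsub>M\<^esub>S) = \<Squnion>\<^bsub>N\<^esub>(f ` S)) \<and>
     (\<forall>S \<subseteq> carrier M. f (\<Sqinter>\<^bsub>M\<^esub>S) = \<Sqinter>\<^bsub>N\<^esub>(f ` S)) \<and>
     (\<forall>a\<in>carrier M. f (neg M a) = neg N (f a)) \<and>
     (\<forall>a\<in>carrier M. f (Box M a) \<sqsubseteq>\<^bsub>N\<^esub> Box N (f a))}"

definition mt_atoms :: "'a mt \<Rightarrow> 'a set" where
  "mt_atoms M = {a \<in> carrier M. a \<noteq> \<bottom>\<^bsub>M\<^esub> \<and>
     (\<forall>b\<in>carrier M. b \<sqsubseteq>\<^bsub>M\<^esub> a \<longrightarrow> b = \<bottom>\<^bsub>M\<^esub> \<or> b = a)}"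


section \<open>Frames\<close>

definition is_frame :: "'a gorder \<Rightarrow> bool" where
  "is_frame L \<longleftrightarrow> complete_lattice L \<and>
     (\<forall>a\<in>carrier L. \<forall>S \<subseteq> carrier L. a \<sqinter>\<^bsub>L\<^esub> \<Squnion>\<^bsub>L\<^esub>S = \<Squnion>\<^bsub>L\<^esub>((\<lambda>s. a \<sqinter>\<^bsub>L\<^esub> s) ` S))"

definition pseudocomplement :: "'a gorder \<Rightarrow> 'a \<Rightarrow> 'a" where
  "pseudocomplement L c = \<Squnion>\<^bsub>L\<^esub>{x \<in> carrier L. x \<sqinter>\<^bsub>L\<^esub> c = \<bottom>\<^bsub>L\<^esub>}"

definition frm_complemented :: "'a gorder \<Rightarrow> 'a set" where
  "frm_complemented L = {c \<in> carrier L. c \<squnion>\<^bsub>L\<^esub> pseudocomplement L c = \<top>\<^bsub>L\<^esub>}"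

definition frm_zero_dimensional :: "'a gorder \<Rightarrow> bool" where
  "frm_zero_dimensional L \<longleftrightarrow>
     (\<forall>a\<in>carrier L. a = \<Squnion>\<^bsub>L\<^esub>{c \<in> frm_complemented L. c \<sqsubseteq>\<^bsub>L\<^esub> a})"

definition frm_compact :: "'a gorder \<Rightarrow> bool" where
  "frm_compact L \<longleftrightarrow>
     (\<forall>S \<subseteq> carrier L. \<Squnion>\<^bsub>L\<^esub>S = \<top>\<^bsub>L\<^esub> \<longrightarrow> (\<exists>T \<subseteq> S. finite T \<and> \<Squnion>\<^bsub>L\<^esub>T = \<top>\<^bsub>L\<^esub>))"

definition stone_frame :: "'a gorder \<Rightarrow> bool" where
  "stone_frame L \<longleftrightarrow> is_frame L \<and> frm_compact L \<and> frm_zero_dimensional L"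

definition frm_hom :: "'a gorder \<Rightarrow> 'b gorder \<Rightarrow> ('a \<Rightarrow> 'b) set" where
  "frm_hom L K = {f \<in> carrier L \<rightarrow>\<^sub>E carrier K.
     f \<top>\<^bsub>L\<^esub> = \<top>\<^bsub>K\<^esub> \<and>
     (\<forall>a\<in>carrier L. \<forall>b\<in>carrier L. f (a \<sqinter>\<^bsub>L\<^esub> b) = f a \<sqinter>\<^bsub>K\<^esub> f b) \<and>
     (\<forall>S \<subseteq> carrier L. f (\<Squnion>\<^bsub>L\<^esub>S) = \<Squnion>\<^bsub>K\<^esub>(f ` S))}"

text \<open>The points of a frame are its frame homomorphisms to the two-element frame.\<close>

definition frm_points :: "'a gorder \<Rightarrow> ('a \<Rightarrow> bool) set" where
  "frm_points L = frm_hom L \<lparr>carrier = UNIV, eq = (=), le = (\<le>)\<rparr>"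


section \<open>Stone spaces\<close>

definition stone_space :: "'a topology \<Rightarrow> bool" where
  "stone_space X \<longleftrightarrow> compact_space X \<and> Hausdorff_space X \<and>
     openin X = arbitrary union_of (\<lambda>U. openin X U \<and> closedin X U)"

definition top_hom :: "'a topology \<Rightarrow> 'b topology \<Rightarrow> ('a \<Rightarrow> 'b) set" where
  "top_hom X Y = {f \<in> extensional (topspace X). continuous_map X Y f}"


section \<open>The three categories\<close>

text \<open>A family \<open>U\<close> of subsets of a type plays the role of a universe of small sets: it is closed
  under passing to sets of smaller or equal cardinality and, up to equipollence, under powersets.
  \<open>U\<close> need not contain all subsets of the type.\<close>

definition universe :: "'u set set \<Rightarrow> bool" where
  "universe U \<longleftrightarrow> (\<forall>A\<in>U. \<forall>B. B \<lesssim> A \<longrightarrow> B \<in> U) \<and> (\<forall>A\<in>U. \<exists>B\<in>U. Pow A \<lesssim> B)"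

text \<open>In each case the objects are the structures whose underlying set belongs to \<open>U\<close>.\<close>

definition StoneMT :: "'u set set \<Rightarrow> ('u mt, 'u \<Rightarrow> 'u) cat" where
  "StoneMT U = \<lparr>Obj = {M. carrier M \<in> U \<and> stone_mt M}, Hom = mt_hom,
     Idn = (\<lambda>M. restrict id (carrier M)), Cmp = (\<lambda>M N K g f. compose (carrier M) g f)\<rparr>"

definition StoneFrm :: "'u set set \<Rightarrow> ('u gorder, 'u \<Rightarrow> 'u) cat" where
  "StoneFrm U = \<lparr>Obj = {L. carrier L \<in> U \<and> stone_frame L}, Hom = frm_hom,
     Idn = (\<lambda>L. restrict id (carrier L)), Cmp = (\<lambda>L K J g f. compose (carrier L) g f)\<rparr>"

definition Stone :: "'u set set \<Rightarrow> ('u topology, 'u \<Rightarrow> 'u) cat" where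
  "Stone U = \<lparr>Obj = {X. topspace X \<in> U \<and> stone_space X}, Hom = top_hom,
     Idn = (\<lambda>X. restrict id (topspace X)), Cmp = (\<lambda>X Y Z g f. compose (topspace X) g f)\<rparr>"

text \<open>HOL alone does not prove that a universe with an infinite member exists (no type provably
  contains all iterated powersets of an infinite set). The following full subcategories need no
  universe: for an arbitrary type \<open>'p\<close> they consist of all Stone spaces on subsets of \<open>'p\<close>, and of
  the Stone MT-algebras and Stone frames with at most \<open>|'p|\<close> atoms, respectively points; \<open>'p set\<close> is
  large enough to carry all of these up to isomorphism. Every Stone MT-algebra, Stone frame and
  Stone space is isomorphic to one that occurs here for a suitable \<open>'p\<close>.\<close>

definition StoneMT_upto :: "'p itself \<Rightarrow> ('p set mt, 'p set \<Rightarrow> 'p set) cat" where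
  "StoneMT_upto _ = full_subcat (StoneMT UNIV) (\<lambda>M. mt_atoms M \<lesssim> (UNIV :: 'p set))"

definition StoneFrm_upto :: "'p itself \<Rightarrow> ('p set gorder, 'p set \<Rightarrow> 'p set) cat" where
  "StoneFrm_upto _ = full_subcat (StoneFrm UNIV) (\<lambda>L. frm_points L \<lesssim> (UNIV :: 'p set))"

end

theory Submission
  imports Defs
begin

text \<open>Each of the three kinds of structure is described by a Stone space: a Stone MT-algebra is the
  powerset of a Stone space with the interior operator, a Stone frame is its lattice of open sets.
  Morphisms of MT-algebras and of frames are then both preimage maps of unique continuous maps, the
  uniqueness and existence of the point map coming from sobriety of Hausdorff spaces (discrete ones
  in the case of MT-algebras).

  The space of a frame consists of its coatoms, which compactness and Zorn's lemma provide in
  sufficient supply; the same maximal elements among the open elements of an MT-algebra are the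
  complements of minimal nonzero closed elements, and those are atoms since every element is a
  join of closed ones. As coatoms and atoms are elements of the lattice, the space lives on a subset
  of its carrier.

  The equivalences are assembled from spans: the objects of the apex are pairs of a lattice and a
  space together with a representation, and no functor has to be chosen by hand.\<close>

section \<open>Equivalences from spans\<close>

text \<open>Within a universe, lattices and spaces live on one type, so an open set is not itself an
  element of a lattice there: a lattice can be tied to a space only by an explicit order
  isomorphism, and that isomorphism is not unique. A span keeps all choices open. Both legs are
  surjective on objects, and R restricts to a bijection between corresponding hom-sets which
  respects identities and composition. Any section of a leg then yields a functor, and two apex
  objects over the same object of D have isomorphic images in C, the isomorphism being the morphism
  related to an identity. Unit and counit thus need no knowledge of MT-algebras or frames.
  Separation axioms enter twice. T0 together with a clopen basis gives Hausdorff, so conditions on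
  the lattice alone determine a Stone space. Hausdorff gives sobriety, so every morphism comes from
  a map of points.\<close>

locale equivalence_span =
  fixes C :: "('o, 'm) cat" and D :: "('p, 'n) cat"
    and I :: "'i set" and p :: "'i \<Rightarrow> 'o" and q :: "'i \<Rightarrow> 'p"
    and R :: "'i \<Rightarrow> 'i \<Rightarrow> 'm \<Rightarrow> 'n \<Rightarrow> bool"
  assumes category_C: "is_category C" and category_D: "is_category D"
    and image_p: "p ` I = Obj C" and image_q: "q ` I = Obj D"
    and left_total: "\<And>i j f. \<lbrakk>i \<in> I; j \<in> I; f \<in> Hom C (p i) (p j)\<rbrakk>
      \<Longrightarrow> \<exists>g\<in>Hom D (q i) (q j). R i j f g"
    and right_total: "\<And>i j g. \<lbrakk>i \<in> I; j \<in> I; g \<in> Hom D (q i) (q j)\<rbrakk>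
      \<Longrightarrow> \<exists>f\<in>Hom C (p i) (p j). R i j f g"
    and right_unique: "\<And>i j f g g'. \<lbrakk>i \<in> I; j \<in> I; f \<in> Hom C (p i) (p j);
      g \<in> Hom D (q i) (q j); g' \<in> Hom D (q i) (q j); R i j f g; R i j f g'\<rbrakk> \<Longrightarrow> g = g'"
    and left_unique: "\<And>i j f f' g. \<lbrakk>i \<in> I; j \<in> I; f \<in> Hom C (p i) (p j);
      f' \<in> Hom C (p i) (p j); g \<in> Hom D (q i) (q j); R i j f g; R i j f' g\<rbrakk> \<Longrightarrow> f = f'"
    and rel_Idn: "\<And>i. i \<in> I \<Longrightarrow> R i i (Idn C (p i)) (Idn D (q i))"
    and rel_Cmp: "\<And>i j k f f' g g'. \<lbrakk>i \<in> I; j \<in> I; k \<in> I;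
      f \<in> Hom C (p i) (p j); f' \<in> Hom C (p j) (p k);
      g \<in> Hom D (q i) (q j); g' \<in> Hom D (q j) (q k); R i j f g; R j k f' g'\<rbrakk>
      \<Longrightarrow> R i k (Cmp C (p i) (p j) (p k) f' f) (Cmp D (q i) (q j) (q k) g' g)"
begin

text \<open>The axioms are symmetric in C and D; interpreting the converse gives every construction
  from C to D also from D to C, under the prefix \<open>conv\<close>.\<close>

lemma equivalence_span_converse: "equivalence_span D C I q p (\<lambda>i j g f. R i j f g)"
  by unfold_locales
    (use category_C category_D image_p image_q left_total right_total rel_Idn rel_Cmp in
      \<open>auto dest: left_unique right_unique\<close>)

lemma p_obj [simp]: "i \<in> I \<Longrightarrow> p i \<in> Obj C" and q_obj [simp]: "i \<in> I \<Longrightarrow> q i \<in> Obj D"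
  using image_p image_q by auto

lemma C_Idn [simp]: "a \<in> Obj C \<Longrightarrow> Idn C a \<in> Hom C a a"
  and C_Cmp [simp]: "\<lbrakk>a \<in> Obj C; b \<in> Obj C; c \<in> Obj C; f \<in> Hom C a b; g \<in> Hom C b c\<rbrakk>
    \<Longrightarrow> Cmp C a b c g f \<in> Hom C a c"
  and C_Cmp_Idn [simp]: "\<lbrakk>a \<in> Obj C; b \<in> Obj C; f \<in> Hom C a b\<rbrakk> \<Longrightarrow> Cmp C a a b f (Idn C a) = f"
    "\<lbrakk>a \<in> Obj C; b \<in> Obj C; f \<in> Hom C a b\<rbrakk> \<Longrightarrow> Cmp C a b b (Idn C b) f = f"
  using category_C unfolding is_category_def by blast+

lemma D_Idn [simp]: "a \<in> Obj D \<Longrightarrow> Idn D a \<in> Hom D a a"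
  and D_Cmp [simp]: "\<lbrakk>a \<in> Obj D; b \<in> Obj D; c \<in> Obj D; f \<in> Hom D a b; g \<in> Hom D b c\<rbrakk>
    \<Longrightarrow> Cmp D a b c g f \<in> Hom D a c"
  and D_Cmp_Idn [simp]: "\<lbrakk>a \<in> Obj D; b \<in> Obj D; f \<in> Hom D a b\<rbrakk> \<Longrightarrow> Cmp D a a b f (Idn D a) = f"
    "\<lbrakk>a \<in> Obj D; b \<in> Obj D; f \<in> Hom D a b\<rbrakk> \<Longrightarrow> Cmp D a b b (Idn D b) f = f"
  using category_D unfolding is_category_def by blast+

text \<open>The genuine choice in the functor sits here, since a leg need not be injective on
  objects. The morphism picked by \<open>trans\<close> is unique by
  \<open>right_unique\<close>.\<close>

definition sec :: "'o \<Rightarrow> 'i" where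
  "sec c = (SOME i. i \<in> I \<and> p i = c)"

definition trans :: "'i \<Rightarrow> 'i \<Rightarrow> 'm \<Rightarrow> 'n" where
  "trans i j f = (SOME g. g \<in> Hom D (q i) (q j) \<and> R i j f g)"

lemma sec: assumes "c \<in> Obj C" shows "sec c \<in> I" "p (sec c) = c"
proof -
  have "\<exists>i. i \<in> I \<and> p i = c" using assms image_p by (metis imageE)
  from someI_ex[OF this] show "sec c \<in> I" "p (sec c) = c" by (auto simp: sec_def)
qed

lemma trans:
  assumes "i \<in> I" "j \<in> I" "f \<in> Hom C (p i) (p j)"
  shows "trans i j f \<in> Hom D (q i) (q j)" "R i j f (trans i j f)"
proof -
  have "\<exists>g. g \<in> Hom D (q i) (q j) \<and> R i j f g" using left_total[OF assms] by blast
  from someI_ex[OF this] show "trans i j f \<in> Hom D (q i) (q j)" "R i j f (trans i j f)"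
    by (auto simp: trans_def)
qed

lemma trans_eqI:
  assumes "i \<in> I" "j \<in> I" "f \<in> Hom C (p i) (p j)" "g \<in> Hom D (q i) (q j)" "R i j f g"
  shows "trans i j f = g"
  using right_unique[OF assms(1-3) trans(1)[OF assms(1-3)] assms(4) trans(2)[OF assms(1-3)] assms(5)] .

lemma trans_Idn: "i \<in> I \<Longrightarrow> trans i i (Idn C (p i)) = Idn D (q i)"
  by (intro trans_eqI rel_Idn) simp_all

lemma trans_Cmp:
  assumes "i \<in> I" "j \<in> I" "k \<in> I" "f \<in> Hom C (p i) (p j)" "f' \<in> Hom C (p j) (p k)"
  shows "trans i k (Cmp C (p i) (p j) (p k) f' f)
    = Cmp D (q i) (q j) (q k) (trans j k f') (trans i j f)"
proof -
  note t = trans[OF assms(1,2,4)] trans[OF assms(2,3,5)]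
  show ?thesis
    by (intro trans_eqI rel_Cmp) (use assms t in auto)
qed

lemma functor_trans:
  "is_functor C D (\<lambda>c. q (sec c)) (\<lambda>a b. trans (sec a) (sec b))"
  unfolding is_functor_def
proof (intro conjI ballI)
  fix a assume a: "a \<in> Obj C"
  note sa = sec[OF a]
  show "q (sec a) \<in> Obj D" using sa by simp
  show "trans (sec a) (sec a) (Idn C a) = Idn D (q (sec a))"
    using trans_Idn[OF sa(1)] sa(2) by simp
  fix b f assume b: "b \<in> Obj C" and f: "f \<in> Hom C a b"
  note sb = sec[OF b]
  show "trans (sec a) (sec b) f \<in> Hom D (q (sec a)) (q (sec b))"
    by (rule trans(1)) (use sa sb f in auto)
next
  fix a b c f g
  assume o: "a \<in> Obj C" "b \<in> Obj C" "c \<in> Obj C" and fg: "f \<in> Hom C a b" "g \<in> Hom C b c"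
  note s = sec[OF o(1)] sec[OF o(2)] sec[OF o(3)]
  show "trans (sec a) (sec c) (Cmp C a b c g f) =
     Cmp D (q (sec a)) (q (sec b)) (q (sec c)) (trans (sec b) (sec c) g) (trans (sec a) (sec b) f)"
    using trans_Cmp[OF s(1,3,5), of f g] s fg by simp
qed

end

section \<open>Unit and counit\<close>

context equivalence_span
begin

interpretation conv: equivalence_span D C I q p "\<lambda>i j g f. R i j f g"
  by (rule equivalence_span_converse)

lemma conv_trans_trans:
  "\<lbrakk>i \<in> I; j \<in> I; f \<in> Hom C (p i) (p j)\<rbrakk> \<Longrightarrow> conv.trans i j (trans i j f) = f"
  by (intro conv.trans_eqI trans)

text \<open>Apex objects i and j over the same object of D are compared by transporting its identity
  to C. Transport respects composition, so the two directions cancel.\<close>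

lemma conv_trans_inverse:
  assumes "i \<in> I" "j \<in> I" "q i = q j"
  shows "Cmp C (p i) (p j) (p i) (conv.trans j i (Idn D (q i))) (conv.trans i j (Idn D (q i)))
    = Idn C (p i)"
  using conv.trans_Cmp[of i j i "Idn D (q i)" "Idn D (q i)"] conv.trans_Idn[of i] assms
    D_Cmp_Idn(1)[of "q i" "q i" "Idn D (q i)"]
  by (simp del: conv.D_Cmp_Idn)

lemma is_iso_conv_trans_Idn:
  assumes "i \<in> I" "j \<in> I" "q i = q j"
  shows "is_iso C (p i) (p j) (conv.trans i j (Idn D (q i)))"
  unfolding is_iso_def
proof (intro conjI bexI)
  show "conv.trans i j (Idn D (q i)) \<in> Hom C (p i) (p j)"
    "conv.trans j i (Idn D (q i)) \<in> Hom C (p j) (p i)"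
    by (rule conv.trans(1); use assms in \<open>simp; fail\<close>)+
qed (use conv_trans_inverse[OF assms] conv_trans_inverse[of j i] assms in auto)

text \<open>Both paths of the square are the transport of one morphism of D, namely the common image
  of f and g composed with an identity on either side.\<close>

lemma conv_trans_natural:
  assumes "i \<in> I" "j \<in> I" "i' \<in> I" "j' \<in> I" "q i = q j" "q i' = q j'"
    and f: "f \<in> Hom C (p i) (p i')" and g: "g \<in> Hom C (p j) (p j')"
    and eq: "trans i i' f = trans j j' g"
  shows "Cmp C (p i) (p i') (p j') (conv.trans i' j' (Idn D (q i'))) f
    = Cmp C (p i) (p j) (p j') g (conv.trans i j (Idn D (q i)))"
proof -
  let ?h = "trans i i' f"
  have h: "?h \<in> Hom D (q i) (q i')" by (rule trans(1)) (use assms in auto)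
  have hi: "conv.trans i i' ?h = f" "conv.trans j j' ?h = g"
    using conv_trans_trans[OF assms(1,3) f] conv_trans_trans[OF assms(2,4) g] by (simp_all add: eq)
  have "Cmp C (p i) (p i') (p j') (conv.trans i' j' (Idn D (q i'))) f
      = conv.trans i j' (Cmp D (q i) (q i') (q j') (Idn D (q i')) ?h)"
    using conv.trans_Cmp[of i i' j' ?h "Idn D (q i')"] hi h assms by simp
  also have "Cmp D (q i) (q i') (q j') (Idn D (q i')) ?h = ?h"
    using h D_Cmp_Idn(2)[of "q i" "q i'" ?h] assms by simp
  also have "?h = Cmp D (q i) (q j) (q j') ?h (Idn D (q i))"
    using h D_Cmp_Idn(1)[of "q i" "q i'" ?h] assms by simp
  also have "conv.trans i j' \<dots> = Cmp C (p i) (p j) (p j') g (conv.trans i j (Idn D (q i)))"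
    using conv.trans_Cmp[of i j j' "Idn D (q i)" ?h] hi h assms by simp
  finally show ?thesis .
qed

lemma trans_conv_trans:
  "\<lbrakk>i \<in> I; j \<in> I; g \<in> Hom D (q i) (q j)\<rbrakk> \<Longrightarrow> trans i j (conv.trans i j g) = g"
  by (intro trans_eqI conv.trans)

text \<open>\<open>sec a\<close> and \<open>conv.sec (q (sec a))\<close> lie over the same object of
  D; the component at a is their comparison isomorphism.\<close>

lemma natural_iso_unit:
  "natural_iso C C (\<lambda>a. a) (\<lambda>a b f. f) (\<lambda>a. p (conv.sec (q (sec a))))
    (\<lambda>a b f. conv.trans (conv.sec (q (sec a))) (conv.sec (q (sec b))) (trans (sec a) (sec b) f))
    (\<lambda>a. conv.trans (sec a) (conv.sec (q (sec a))) (Idn D (q (sec a))))"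
  unfolding natural_iso_def
proof (intro conjI ballI)
  fix a assume a: "a \<in> Obj C"
  note sa = sec[OF a] and ta = conv.sec[OF q_obj[OF sec(1)[OF a]]]
  show "is_iso C a (p (conv.sec (q (sec a))))
      (conv.trans (sec a) (conv.sec (q (sec a))) (Idn D (q (sec a))))"
    using is_iso_conv_trans_Idn[of "sec a" "conv.sec (q (sec a))"] sa ta by simp
  fix b f assume b: "b \<in> Obj C" and f: "f \<in> Hom C a b"
  note sb = sec[OF b] and tb = conv.sec[OF q_obj[OF sec(1)[OF b]]]
  let ?g = "conv.trans (conv.sec (q (sec a))) (conv.sec (q (sec b))) (trans (sec a) (sec b) f)"
  have t: "trans (sec a) (sec b) f \<in> Hom D (q (sec a)) (q (sec b))"
    by (rule trans(1)) (use sa sb f in auto)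
  have g: "?g \<in> Hom C (p (conv.sec (q (sec a)))) (p (conv.sec (q (sec b))))"
    by (rule conv.trans(1)) (use ta tb t in auto)
  have "trans (conv.sec (q (sec a))) (conv.sec (q (sec b))) ?g = trans (sec a) (sec b) f"
    by (rule trans_conv_trans) (use ta tb t in auto)
  then show "Cmp C a b (p (conv.sec (q (sec b))))
      (conv.trans (sec b) (conv.sec (q (sec b))) (Idn D (q (sec b)))) f
    = Cmp C a (p (conv.sec (q (sec a)))) (p (conv.sec (q (sec b)))) ?g
      (conv.trans (sec a) (conv.sec (q (sec a))) (Idn D (q (sec a))))"
    using conv_trans_natural[of "sec a" "conv.sec (q (sec a))" "sec b" "conv.sec (q (sec b))" f ?g]
      sa ta sb tb f g by simp
qed

text \<open>The comparison isomorphisms of the unit in the opposite direction. Stated for C, so that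
  the converse span turns it into a statement about D.\<close>

lemma natural_iso_counit:
  "natural_iso C C (\<lambda>a. p (conv.sec (q (sec a))))
    (\<lambda>a b f. conv.trans (conv.sec (q (sec a))) (conv.sec (q (sec b))) (trans (sec a) (sec b) f))
    (\<lambda>a. a) (\<lambda>a b f. f)
    (\<lambda>a. conv.trans (conv.sec (q (sec a))) (sec a) (Idn D (q (sec a))))"
  unfolding natural_iso_def
proof (intro conjI ballI)
  fix a assume a: "a \<in> Obj C"
  note sa = sec[OF a] and ta = conv.sec[OF q_obj[OF sec(1)[OF a]]]
  show "is_iso C (p (conv.sec (q (sec a)))) a
      (conv.trans (conv.sec (q (sec a))) (sec a) (Idn D (q (sec a))))"
    using is_iso_conv_trans_Idn[of "conv.sec (q (sec a))" "sec a"] sa ta by simp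
  fix b f assume b: "b \<in> Obj C" and f: "f \<in> Hom C a b"
  note sb = sec[OF b] and tb = conv.sec[OF q_obj[OF sec(1)[OF b]]]
  let ?g = "conv.trans (conv.sec (q (sec a))) (conv.sec (q (sec b))) (trans (sec a) (sec b) f)"
  have t: "trans (sec a) (sec b) f \<in> Hom D (q (sec a)) (q (sec b))"
    by (rule trans(1)) (use sa sb f in auto)
  have g: "?g \<in> Hom C (p (conv.sec (q (sec a)))) (p (conv.sec (q (sec b))))"
    by (rule conv.trans(1)) (use ta tb t in auto)
  have "trans (conv.sec (q (sec a))) (conv.sec (q (sec b))) ?g = trans (sec a) (sec b) f"
    by (rule trans_conv_trans) (use ta tb t in auto)
  then show "Cmp C (p (conv.sec (q (sec a)))) (p (conv.sec (q (sec b)))) b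
      (conv.trans (conv.sec (q (sec b))) (sec b) (Idn D (q (sec b)))) ?g
    = Cmp C (p (conv.sec (q (sec a)))) a b f
      (conv.trans (conv.sec (q (sec a))) (sec a) (Idn D (q (sec a))))"
    using conv_trans_natural[of "conv.sec (q (sec a))" "sec a" "conv.sec (q (sec b))" "sec b" ?g f]
      sa ta sb tb f g by simp
qed

end

context equivalence_span
begin

interpretation conv: equivalence_span D C I q p "\<lambda>i j g f. R i j f g"
  by (rule equivalence_span_converse)

text \<open>The \<open>\<epsilon>\<close> on D is the \<open>natural_iso_counit\<close> of the
  converse span: with the legs exchanged, that lemma speaks of the passage from D to C and
  back.\<close>

theorem equivalent: "equivalent C D"
  unfolding equivalent_def
  using category_C category_D functor_trans conv.functor_trans natural_iso_unit
    conv.natural_iso_counit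
  by blast

end

text \<open>The apex is the pullback over the objects of D, and morphisms are related through a
  mediating morphism of D. The outer legs stay surjective because each inner leg hits every object
  of D.\<close>

lemma equivalence_span_compose:
  assumes "equivalence_span C D I p q R" "equivalence_span D E J p' q' R'"
  shows "equivalence_span C E {(i, j). i \<in> I \<and> j \<in> J \<and> q i = p' j} (\<lambda>(i, j). p i) (\<lambda>(i, j). q' j)
    (\<lambda>(i, j) (i', j') f h. \<exists>g\<in>Hom D (q i) (q i'). R i i' f g \<and> R' j j' g h)"
proof -
  interpret A: equivalence_span C D I p q R by fact
  interpret B: equivalence_span D E J p' q' R' by fact
  let ?K = "{(i, j). i \<in> I \<and> j \<in> J \<and> q i = p' j}"
  show ?thesis
  proof (unfold_locales, goal_cases)
    case 1 show ?case by (rule A.category_C)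
  next
    case 2 show ?case by (rule B.category_D)
  next
    case 3
    have "p i \<in> (\<lambda>(i, j). p i) ` ?K" if i: "i \<in> I" for i
    proof -
      obtain j where "j \<in> J" "p' j = q i" using A.q_obj[OF i] B.image_p by (metis imageE)
      with i show ?thesis by force
    qed
    then show ?case unfolding A.image_p[symmetric] by auto
  next
    case 4
    have "q' j \<in> (\<lambda>(i, j). q' j) ` ?K" if j: "j \<in> J" for j
    proof -
      obtain i where "i \<in> I" "q i = p' j" using B.p_obj[OF j] A.image_q by (metis imageE)
      with j show ?thesis by force
    qed
    then show ?case unfolding B.image_q[symmetric] by auto
  next
    case (5 k l f) then show ?case
      using A.left_total B.left_total by (fastforce split: prod.splits)
  next
    case (6 k l f) then show ?case
      using A.right_total B.right_total by (fastforce split: prod.splits)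
  next
    case (7 k l f g g') then show ?case
      using A.right_unique B.right_unique by (clarsimp split: prod.splits) metis
  next
    case (8 k l f g g') then show ?case
      using A.left_unique B.left_unique by (clarsimp split: prod.splits) metis
  next
    case (9 k)
    then obtain i j where k: "k = (i, j)" "i \<in> I" "j \<in> J" "q i = p' j" by auto
    then show ?case using A.rel_Idn[of i] B.rel_Idn[of j] A.q_obj[of i] by force
  next
    case (10 k l m f f' h h')
    then obtain i j i' j' i'' j'' where k: "k = (i, j)" "l = (i', j')" "m = (i'', j'')"
      "i \<in> I" "j \<in> J" "q i = p' j" "i' \<in> I" "j' \<in> J" "q i' = p' j'"
      "i'' \<in> I" "j'' \<in> J" "q i'' = p' j''" by auto
    with 10 obtain g g' where "g \<in> Hom D (q i) (q i')" "R i i' f g" "R' j j' g h"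
      "g' \<in> Hom D (q i') (q i'')" "R i' i'' f' g'" "R' j' j'' g' h'" by auto
    moreover from calculation k have "Cmp D (q i) (q i') (q i'') g' g \<in> Hom D (q i) (q i'')"
      by (intro A.D_Cmp) auto
    ultimately show ?case
      using A.rel_Cmp[of i i' i'' f f' g g'] B.rel_Cmp[of j j' j'' g g' h h'] 10 k by auto
  qed
qed

section \<open>Lattices represented by the open sets of a space\<close>

text \<open>The type \<open>gorder_scheme\<close> also covers records extended by
  \<open>Box\<close>, so MT-algebras are represented by the same locale as frames.\<close>

locale frm_rep = complete_lattice L for L :: "('b, 'e) gorder_scheme" (structure) +
  fixes X :: "'a topology" and r :: "'b \<Rightarrow> 'a set"
  assumes rep_bij: "bij_betw r (carrier L) {U. openin X U}"
    and rep_le: "\<And>a b. \<lbrakk>a \<in> carrier L; b \<in> carrier L\<rbrakk> \<Longrightarrow> a \<sqsubseteq> b \<longleftrightarrow> r a \<subseteq> r b"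
begin

definition abs :: "'a set \<Rightarrow> 'b" where
  "abs U = inv_into (carrier L) r U"

lemma openin_rep: "a \<in> carrier L \<Longrightarrow> openin X (r a)"
  using rep_bij by (auto simp: bij_betw_def)

lemma rep_subset: "a \<in> carrier L \<Longrightarrow> r a \<subseteq> topspace X"
  using openin_rep openin_subset by blast

lemma rep_eq_iff: "\<lbrakk>a \<in> carrier L; b \<in> carrier L\<rbrakk> \<Longrightarrow> r a = r b \<longleftrightarrow> a = b"
  using rep_bij by (auto simp: bij_betw_def inj_on_def)

lemma abs_closed: "openin X U \<Longrightarrow> abs U \<in> carrier L"
  and rep_abs: "openin X U \<Longrightarrow> r (abs U) = U"
  using rep_bij unfolding abs_def bij_betw_def
  by (auto intro!: inv_into_into f_inv_into_f)

lemma abs_rep: "a \<in> carrier L \<Longrightarrow> abs (r a) = a"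
  using rep_bij unfolding abs_def by (simp add: bij_betw_def)

text \<open>The union of the represented sets is open, hence represented by an element, and that
  element is an upper bound of S. The dual argument works only for finite meets, as an intersection
  of open sets need not be open.\<close>

lemma rep_sup:
  assumes S: "S \<subseteq> carrier L"
  shows "r (\<Squnion>S) = \<Union>(r ` S)"
proof
  have o: "openin X (\<Union>(r ` S))" using S openin_rep by blast
  have "\<Squnion>S \<sqsubseteq> abs (\<Union>(r ` S))"
    using S abs_closed[OF o] rep_abs[OF o] rep_le
    by (intro sup_least) (auto simp: Upper_def subset_eq)
  then show "r (\<Squnion>S) \<subseteq> \<Union>(r ` S)"
    using S abs_closed[OF o] rep_abs[OF o] rep_le sup_closed[OF S] by auto
  show "\<Union>(r ` S) \<subseteq> r (\<Squnion>S)"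
    using S sup_upper[OF S] rep_le sup_closed[OF S] by blast
qed

lemma rep_join: "\<lbrakk>a \<in> carrier L; b \<in> carrier L\<rbrakk> \<Longrightarrow> r (a \<squnion> b) = r a \<union> r b"
  by (simp add: join_def rep_sup)

lemma rep_meet:
  assumes "a \<in> carrier L" "b \<in> carrier L"
  shows "r (a \<sqinter> b) = r a \<inter> r b"
proof
  show "r (a \<sqinter> b) \<subseteq> r a \<inter> r b"
    using meet_left[OF assms] meet_right[OF assms] assms rep_le by simp
  have o: "openin X (r a \<inter> r b)" using assms openin_rep by blast
  have "abs (r a \<inter> r b) \<sqsubseteq> a \<sqinter> b"
    using assms abs_closed[OF o] rep_abs[OF o] rep_le by (intro meet_le) auto
  then show "r a \<inter> r b \<subseteq> r (a \<sqinter> b)"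
    using assms abs_closed[OF o] rep_abs[OF o] rep_le by simp
qed

lemma rep_bottom: "r \<bottom> = {}"
  using rep_le[of "\<bottom>" "abs {}"] abs_closed[of "{}"] rep_abs[of "{}"] by simp

lemma rep_top: "r \<top> = topspace X"
  using rep_le[of "abs (topspace X)" "\<top>"] abs_closed[of "topspace X"] rep_abs[of "topspace X"]
    rep_subset[of "\<top>"] by auto

lemma image_abs: "\<forall>U\<in>\<U>. openin X U \<Longrightarrow> abs ` \<U> \<subseteq> carrier L"
  and rep_image_abs: "\<forall>U\<in>\<U>. openin X U \<Longrightarrow> r ` abs ` \<U> = \<U>"
  using abs_closed rep_abs by (force simp: image_iff)+

lemma eq_sup_iff:
  "\<lbrakk>a \<in> carrier L; S \<subseteq> carrier L\<rbrakk> \<Longrightarrow> a = \<Squnion>S \<longleftrightarrow> r a = \<Union>(r ` S)"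
  using rep_eq_iff[of a "\<Squnion>S"] by (simp add: rep_sup)

lemma sup_eq_top_iff: "S \<subseteq> carrier L \<Longrightarrow> \<Squnion>S = \<top> \<longleftrightarrow> \<Union>(r ` S) = topspace X"
  using eq_sup_iff[of "\<top>" S] by (auto simp: rep_top)

end

text \<open>Completeness is inherited from the lattice of open sets. The condition on
  \<open>eq\<close> is there because the orders in question carry their own equivalence in place of
  equality.\<close>

lemma frm_repI:
  fixes L :: "('b, 'e) gorder_scheme" (structure)
  assumes eq: "eq L = (=)"
    and bij: "bij_betw r (carrier L) {U. openin X U}"
    and le: "\<And>a b. \<lbrakk>a \<in> carrier L; b \<in> carrier L\<rbrakk> \<Longrightarrow> a \<sqsubseteq> b \<longleftrightarrow> r a \<subseteq> r b"
  shows "frm_rep L X r"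
proof -
  have inj: "a = b" if "a \<in> carrier L" "b \<in> carrier L" "r a = r b" for a b
    using bij that by (auto simp: bij_betw_def inj_on_def)
  have op: "openin X (r a)" if "a \<in> carrier L" for a
    using bij that by (auto simp: bij_betw_def)
  have ex: "\<exists>a\<in>carrier L. r a = U" if U: "openin X U" for U
  proof -
    have "U \<in> r ` carrier L" using bij U by (simp add: bij_betw_def)
    then show ?thesis by blast
  qed
  interpret partial_order L
    by unfold_locales (use inj in \<open>auto simp: eq le\<close>)
  have "complete_lattice L"
  proof (rule complete_latticeI)
    fix A assume A: "A \<subseteq> carrier L"
    then obtain s where s: "s \<in> carrier L" "r s = \<Union>(r ` A)"
      using ex[of "\<Union>(r ` A)"] op by blast
    show "\<exists>s. least L s (Upper L A)"
    proof (rule exI[of _ s], rule least_UpperI)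
      fix y assume "y \<in> Upper L A"
      then have "y \<in> carrier L" "\<forall>a\<in>A. r a \<subseteq> r y" using A le by (auto simp: Upper_def subset_eq)
      then show "s \<sqsubseteq> y" using le s by auto
    next
      fix a assume "a \<in> A"
      moreover from this have "a \<in> carrier L" using A by blast
      ultimately show "a \<sqsubseteq> s" using le s by auto
    qed (use A s in auto)
    \<comment> \<open>The infimum is the interior of the intersection, written as a union of open
      sets; for empty A it is the whole space.\<close>
    obtain i where i: "i \<in> carrier L" "r i = \<Union>{U. openin X U \<and> (\<forall>a\<in>A. U \<subseteq> r a)}"
      using ex[of "\<Union>{U. openin X U \<and> (\<forall>a\<in>A. U \<subseteq> r a)}"] by blast
    show "\<exists>i. greatest L i (Lower L A)"
    proof (rule exI[of _ i], rule greatest_LowerI)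
      fix y assume "y \<in> Lower L A"
      then have "y \<in> carrier L" "\<forall>a\<in>A. r y \<subseteq> r a" using A le by (auto simp: Lower_def subset_eq)
      then show "y \<sqsubseteq> i" using op le i by auto
    next
      fix a assume a: "a \<in> A"
      then have "a \<in> carrier L" using A by blast
      then show "i \<sqsubseteq> a" using le[of i a] i a by auto
    qed (use A i in auto)
  qed
  then interpret complete_lattice L .
  show ?thesis by unfold_locales (use bij le in auto)
qed

section \<open>Stone conditions on spaces in terms of open sets\<close>

lemma zero_dimensional_iff:
  "openin X = arbitrary union_of (\<lambda>U. openin X U \<and> closedin X U) \<longleftrightarrow>
   (\<forall>U. openin X U \<longrightarrow> U = \<Union>{C. openin X C \<and> closedin X C \<and> C \<subseteq> U})"
  (is "?l \<longleftrightarrow> ?r")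
proof
  assume ?l
  show ?r
  proof (intro allI impI)
    fix U assume "openin X U"
    with fun_cong[OF \<open>?l\<close>, of U] have "(arbitrary union_of (\<lambda>U. openin X U \<and> closedin X U)) U"
      by (rule iffD1)
    then obtain \<U> where "\<U> \<subseteq> Collect (\<lambda>U. openin X U \<and> closedin X U)" "\<Union>\<U> = U"
      unfolding union_of_def by blast
    then show "U = \<Union>{C. openin X C \<and> closedin X C \<and> C \<subseteq> U}" by blast
  qed
next
  assume ?r
  show ?l
  proof
    fix U show "openin X U = (arbitrary union_of (\<lambda>U. openin X U \<and> closedin X U)) U"
    proof
      assume "openin X U"
      then have "U = \<Union>{C. openin X C \<and> closedin X C \<and> C \<subseteq> U}" using \<open>?r\<close> by blast
      then show "(arbitrary union_of (\<lambda>U. openin X U \<and> closedin X U)) U"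
        unfolding union_of_def arbitrary_def
        by (intro exI[of _ "{C. openin X C \<and> closedin X C \<and> C \<subseteq> U}"]) auto
    next
      assume "(arbitrary union_of (\<lambda>U. openin X U \<and> closedin X U)) U"
      then show "openin X U" unfolding union_of_def by blast
    qed
  qed
qed

text \<open>Covers are required to equal the space, which is the form in which a join equal to top
  is represented.\<close>

lemma compact_space_iff:
  "compact_space X \<longleftrightarrow> (\<forall>\<U>. (\<forall>U\<in>\<U>. openin X U) \<and> \<Union>\<U> = topspace X \<longrightarrow>
    (\<exists>\<F>\<subseteq>\<U>. finite \<F> \<and> \<Union>\<F> = topspace X))" (is "_ \<longleftrightarrow> ?r")
proof
  assume X: "compact_space X"
  show ?r
  proof (intro allI impI, elim conjE)
    fix \<U> assume U: "\<forall>U\<in>\<U>. openin X U" "\<Union>\<U> = topspace X"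
    then obtain \<F> where "finite \<F>" "\<F> \<subseteq> \<U>" "topspace X \<subseteq> \<Union>\<F>"
      using X unfolding compact_space_alt by (metis subset_refl)
    then show "\<exists>\<F>\<subseteq>\<U>. finite \<F> \<and> \<Union>\<F> = topspace X" using U by (intro exI[of _ \<F>]) blast
  qed
next
  assume r: ?r
  show "compact_space X" unfolding compact_space_alt
  proof (intro allI impI, elim conjE)
    fix \<U> assume U: "Ball \<U> (openin X)" "topspace X \<subseteq> \<Union>\<U>"
    then have "\<Union>\<U> = topspace X" using openin_subset by blast
    then show "\<exists>\<F>. finite \<F> \<and> \<F> \<subseteq> \<U> \<and> topspace X \<subseteq> \<Union>\<F>" using U r by (metis subset_refl)
  qed
qed

text \<open>An open set containing just one of two points can be shrunk to a clopen set around that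
  point; this set and its complement separate the two.\<close>

lemma Hausdorff_if_t0_zero_dimensional:
  assumes "t0_space X" "openin X = arbitrary union_of (\<lambda>U. openin X U \<and> closedin X U)"
  shows "Hausdorff_space X"
  unfolding Hausdorff_space_def
proof (intro allI impI, elim conjE)
  fix x y assume xy: "x \<in> topspace X" "y \<in> topspace X" "x \<noteq> y"
  then obtain U where U: "openin X U" "x \<notin> U \<longleftrightarrow> y \<in> U"
    using assms(1) unfolding t0_space_def by blast
  have U': "U = \<Union>{C. openin X C \<and> closedin X C \<and> C \<subseteq> U}"
    using assms(2) U(1) unfolding zero_dimensional_iff by blast
  have "\<exists>C. openin X C \<and> closedin X C \<and> (x \<notin> C \<longleftrightarrow> y \<in> C)"
  proof (cases "x \<in> U")
    case True
    then obtain C where "openin X C" "closedin X C" "C \<subseteq> U" "x \<in> C" using U' by blast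
    then show ?thesis using U True by (intro exI[of _ C]) blast
  next
    case False
    then obtain C where "openin X C" "closedin X C" "C \<subseteq> U" "y \<in> C" using U U' by blast
    then show ?thesis using U False by (intro exI[of _ C]) blast
  qed
  then obtain C where C: "openin X C" "openin X (topspace X - C)" "x \<notin> C \<longleftrightarrow> y \<in> C"
    by (auto simp: closedin_def)
  then show "\<exists>U V. openin X U \<and> openin X V \<and> x \<in> U \<and> y \<in> V \<and> disjnt U V"
    using xy by (cases "x \<in> C") (metis DiffI disjnt_iff DiffD2)+
qed

section \<open>Frames of open sets\<close>

locale frame_rep = frm_rep L X r for L :: "'b gorder" (structure) and X :: "'a topology" and r
begin

lemma is_frame: "is_frame L"
  unfolding is_frame_def
proof (intro conjI ballI allI impI)
  fix a S assume a: "a \<in> carrier L" and S: "S \<subseteq> carrier L"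
  have "(\<lambda>s. a \<sqinter> s) ` S \<subseteq> carrier L" using a S by auto
  moreover have "r (a \<sqinter> \<Squnion>S) = \<Union>(r ` (\<lambda>s. a \<sqinter> s) ` S)"
    using a S by (auto simp: rep_meet rep_sup subset_iff)
  ultimately show "a \<sqinter> \<Squnion>S = \<Squnion>((\<lambda>s. a \<sqinter> s) ` S)"
    using a S eq_sup_iff[of "a \<sqinter> \<Squnion>S"] by simp
qed unfold_locales

lemma frm_compact_iff: "frm_compact L \<longleftrightarrow> compact_space X"
  unfolding frm_compact_def compact_space_iff
proof (intro iffI allI impI)
  fix \<U> assume c: "\<forall>S\<subseteq>carrier L. \<Squnion>S = \<top> \<longrightarrow> (\<exists>T\<subseteq>S. finite T \<and> \<Squnion>T = \<top>)"
    and "(\<forall>U\<in>\<U>. openin X U) \<and> \<Union>\<U> = topspace X"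
  then have U: "\<forall>U\<in>\<U>. openin X U" "\<Union>\<U> = topspace X" by auto
  have "\<Squnion>(abs ` \<U>) = \<top>"
    using sup_eq_top_iff[OF image_abs[OF U(1)]] rep_image_abs[OF U(1)] U by simp
  then obtain T where T: "T \<subseteq> abs ` \<U>" "finite T" "\<Squnion>T = \<top>"
    using c[rule_format, OF image_abs[OF U(1)]] by blast
  then have "r ` T \<subseteq> \<U>" using image_mono[of T "abs ` \<U>" r] rep_image_abs[OF U(1)] by simp
  moreover have "\<Union>(r ` T) = topspace X"
    using T(3) sup_eq_top_iff[OF subset_trans[OF T(1) image_abs[OF U(1)]]] by simp
  ultimately show "\<exists>\<F>\<subseteq>\<U>. finite \<F> \<and> \<Union>\<F> = topspace X"
    using T(2) by (intro exI[of _ "r ` T"]) simp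
next
  fix S assume c: "\<forall>\<U>. (\<forall>U\<in>\<U>. openin X U) \<and> \<Union>\<U> = topspace X \<longrightarrow>
        (\<exists>\<F>\<subseteq>\<U>. finite \<F> \<and> \<Union>\<F> = topspace X)"
    and S: "S \<subseteq> carrier L" "\<Squnion>S = \<top>"
  have "\<forall>U\<in>r ` S. openin X U" "\<Union>(r ` S) = topspace X"
    using S openin_rep sup_eq_top_iff[of S] by auto
  then obtain \<F> where F: "\<F> \<subseteq> r ` S" "finite \<F>" "\<Union>\<F> = topspace X"
    using c[rule_format, of "r ` S"] by blast
  then obtain T where "T \<subseteq> S" "finite T" "\<F> = r ` T" by (meson finite_subset_image)
  moreover from this S F have "\<Squnion>T = \<top>" using sup_eq_top_iff[of T] by simp
  ultimately show "\<exists>T\<subseteq>S. finite T \<and> \<Squnion>T = \<top>" by blast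
qed

text \<open>The pseudocomplement of an open set is the interior of its complement. Together the two
  cover the space exactly when that complement is already open.\<close>

lemma frm_complemented_iff: "c \<in> frm_complemented L \<longleftrightarrow> c \<in> carrier L \<and> closedin X (r c)"
proof -
  let ?P = "{x \<in> carrier L. x \<sqinter> c = \<bottom>}"
  have "c \<squnion> \<Squnion>?P = \<top> \<longleftrightarrow> closedin X (r c)" if c: "c \<in> carrier L"
  proof -
    have "x \<sqinter> c = \<bottom> \<longleftrightarrow> r x \<inter> r c = {}" if "x \<in> carrier L" for x
      using c that rep_eq_iff[of "x \<sqinter> c" "\<bottom>"] by (simp add: rep_meet rep_bottom)
    then have P: "?P = {x \<in> carrier L. r x \<inter> r c = {}}" by blast
    have P': "?P \<subseteq> carrier L" by auto
    have disj: "\<Union>(r ` ?P) \<subseteq> topspace X - r c"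
      unfolding P by (auto dest: subsetD[OF rep_subset])
    have "c \<squnion> \<Squnion>?P = \<top> \<longleftrightarrow> r c \<union> \<Union>(r ` ?P) = topspace X"
      using c P' rep_eq_iff[of "c \<squnion> \<Squnion>?P" "\<top>"] by (simp add: rep_join rep_sup rep_top)
    also have "\<dots> \<longleftrightarrow> \<Union>(r ` ?P) = topspace X - r c"
      using rep_subset[OF c] disj by auto
    also have "\<dots> \<longleftrightarrow> openin X (topspace X - r c)"
    proof
      assume e: "\<Union>(r ` ?P) = topspace X - r c"
      have "openin X (\<Union>(r ` ?P))" using openin_rep by auto
      then show "openin X (topspace X - r c)" unfolding e .
    next
      assume o: "openin X (topspace X - r c)"
      then have "abs (topspace X - r c) \<in> ?P" unfolding P by (auto simp: abs_closed rep_abs)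
      then have "r (abs (topspace X - r c)) \<subseteq> \<Union>(r ` ?P)" by (rule UN_upper)
      then show "\<Union>(r ` ?P) = topspace X - r c" using disj rep_abs[OF o] by simp
    qed
    finally show ?thesis using rep_subset[OF c] by (simp add: closedin_def)
  qed
  then show ?thesis unfolding frm_complemented_def pseudocomplement_def by auto
qed

lemma frm_zero_dimensional_iff:
  "frm_zero_dimensional L \<longleftrightarrow>
    openin X = arbitrary union_of (\<lambda>U. openin X U \<and> closedin X U)"
proof -
  have "a = \<Squnion>{c \<in> frm_complemented L. c \<sqsubseteq> a} \<longleftrightarrow>
      r a = \<Union>{C. openin X C \<and> closedin X C \<and> C \<subseteq> r a}" if a: "a \<in> carrier L" for a
  proof -
    have "r ` {c \<in> frm_complemented L. c \<sqsubseteq> a} = {C. openin X C \<and> closedin X C \<and> C \<subseteq> r a}"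
      (is "r ` ?A = ?B")
    proof
      show "r ` ?A \<subseteq> ?B" using a openin_rep rep_le by (auto simp: frm_complemented_iff)
      show "?B \<subseteq> r ` ?A"
      proof
        fix C assume "C \<in> ?B"
        then have "abs C \<in> ?A" "r (abs C) = C"
          using a abs_closed rep_abs rep_le by (auto simp: frm_complemented_iff)
        then show "C \<in> r ` ?A" by (metis imageI)
      qed
    qed
    moreover have "{c \<in> frm_complemented L. c \<sqsubseteq> a} \<subseteq> carrier L"
      by (auto simp: frm_complemented_iff)
    ultimately show ?thesis using a eq_sup_iff by simp
  qed
  then have "frm_zero_dimensional L \<longleftrightarrow>
      (\<forall>a\<in>carrier L. r a = \<Union>{C. openin X C \<and> closedin X C \<and> C \<subseteq> r a})"
    unfolding frm_zero_dimensional_def by (intro ball_cong refl) simp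
  also have "\<dots> \<longleftrightarrow> (\<forall>U. openin X U \<longrightarrow> U = \<Union>{C. openin X C \<and> closedin X C \<and> C \<subseteq> U})"
  proof (intro iffI allI impI ballI)
    fix U assume *: "\<forall>a\<in>carrier L. r a = \<Union>{C. openin X C \<and> closedin X C \<and> C \<subseteq> r a}"
      and U: "openin X U"
    show "U = \<Union>{C. openin X C \<and> closedin X C \<and> C \<subseteq> U}"
      using bspec[OF * abs_closed[OF U]] unfolding rep_abs[OF U] .
  next
    fix a assume *: "\<forall>U. openin X U \<longrightarrow> U = \<Union>{C. openin X C \<and> closedin X C \<and> C \<subseteq> U}"
      and a: "a \<in> carrier L"
    show "r a = \<Union>{C. openin X C \<and> closedin X C \<and> C \<subseteq> r a}"
      by (rule *[rule_format, OF openin_rep[OF a]])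
  qed
  finally show ?thesis unfolding zero_dimensional_iff .
qed

text \<open>Open sets cannot distinguish a space from its T0 quotient, whence the hypothesis; given
  T0, the clopen basis supplies Hausdorffness.\<close>

lemma stone_frame_iff: "t0_space X \<Longrightarrow> stone_frame L \<longleftrightarrow> stone_space X"
  using is_frame Hausdorff_if_t0_zero_dimensional[of X]
  unfolding stone_frame_def stone_space_def frm_compact_iff frm_zero_dimensional_iff by blast

end

text \<open>As a complete boolean algebra, the powerset of a space is the frame of opens of the discrete
  topology, so the general facts on \<open>frm_rep\<close> apply; the topology of \<open>X\<close> enters via \<open>Box\<close> only.\<close>

locale mt_rep = frm_rep M "discrete_topology (topspace X)" r
    for M :: "'b mt" (structure) and X :: "'a topology" and r +
  assumes Box_closed: "a \<in> carrier M \<Longrightarrow> Box M a \<in> carrier M"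
    and rep_Box: "a \<in> carrier M \<Longrightarrow> r (Box M a) = X interior_of r a"
begin

text \<open>The factor \<open>topspace X\<close> matters for empty S, where the intersection alone
  would be the whole type.\<close>

lemma rep_inf:
  assumes S: "S \<subseteq> carrier M"
  shows "r (\<Sqinter>S) = topspace X \<inter> \<Inter>(r ` S)"
proof
  show "r (\<Sqinter>S) \<subseteq> topspace X \<inter> \<Inter>(r ` S)"
    using S inf_lower[OF S] rep_le[OF inf_closed[OF S]] rep_subset[OF inf_closed[OF S]] by auto
  have o: "openin (discrete_topology (topspace X)) (topspace X \<inter> \<Inter>(r ` S))" by simp
  have "abs (topspace X \<inter> \<Inter>(r ` S)) \<sqsubseteq> \<Sqinter>S"
    using S abs_closed[OF o] rep_abs[OF o] rep_le
    by (intro inf_greatest) (auto simp: Lower_def subset_iff)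
  then show "topspace X \<inter> \<Inter>(r ` S) \<subseteq> r (\<Sqinter>S)"
    using S abs_closed[OF o] rep_abs[OF o] rep_le by simp
qed

lemma neg_unique:
  assumes a: "a \<in> carrier M" and y: "y \<in> carrier M"
  shows "a \<sqinter> y = \<bottom> \<and> a \<squnion> y = \<top> \<longleftrightarrow> y = abs (topspace X - r a)"
proof -
  have "a \<sqinter> y = \<bottom> \<longleftrightarrow> r a \<inter> r y = {}" "a \<squnion> y = \<top> \<longleftrightarrow> r a \<union> r y = topspace X"
    using rep_eq_iff[of "a \<sqinter> y" "\<bottom>"] rep_eq_iff[of "a \<squnion> y" "\<top>"] a y
    by (simp_all add: rep_meet rep_bottom rep_join rep_top)
  moreover have "y = abs (topspace X - r a) \<longleftrightarrow> r y = topspace X - r a"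
    using rep_eq_iff[of y "abs (topspace X - r a)"] y
    by (simp add: abs_closed rep_abs)
  ultimately show ?thesis using rep_subset[OF a] rep_subset[OF y] by auto
qed

lemma neg_eq_abs: "a \<in> carrier M \<Longrightarrow> neg M a = abs (topspace X - r a)"
  unfolding neg_def
  using neg_unique[of a] by (intro the_equality) (auto simp: abs_closed)

lemma neg_closed: "a \<in> carrier M \<Longrightarrow> neg M a \<in> carrier M"
  and rep_neg: "a \<in> carrier M \<Longrightarrow> r (neg M a) = topspace X - r a"
  by (simp_all add: neg_eq_abs abs_closed rep_abs)

lemma Dia_closed: "a \<in> carrier M \<Longrightarrow> Dia M a \<in> carrier M"
  and rep_Dia: "a \<in> carrier M \<Longrightarrow> r (Dia M a) = X closure_of r a"
  unfolding Dia_def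
  using rep_subset[of a]
  by (simp_all add: neg_closed Box_closed rep_neg rep_Box interior_of_complement
      double_diff closure_of_subset_topspace)

lemma mt_algebra: "mt_algebra M"
  unfolding mt_algebra_def complete_boolean_def
proof (intro conjI ballI)
  fix x y z assume c: "x \<in> carrier M" "y \<in> carrier M" "z \<in> carrier M"
  have "r (x \<sqinter> (y \<squnion> z)) = r ((x \<sqinter> y) \<squnion> (x \<sqinter> z))"
    using c by (simp add: rep_meet rep_join Int_Un_distrib)
  then show "x \<sqinter> (y \<squnion> z) = (x \<sqinter> y) \<squnion> (x \<sqinter> z)" using c rep_eq_iff by simp
next
  fix x assume x: "x \<in> carrier M"
  show "\<exists>y\<in>carrier M. x \<sqinter> y = \<bottom> \<and> x \<squnion> y = \<top>"
    using neg_unique[OF x neg_closed[OF x]] neg_closed[OF x] neg_eq_abs[OF x] by auto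
next
  show "Box M \<in> carrier M \<rightarrow> carrier M" using Box_closed by blast
  show "Box M \<top> = \<top>"
    using rep_eq_iff[of "Box M \<top>" "\<top>"]
    by (simp add: Box_closed rep_Box rep_top)
next
  fix a b assume "a \<in> carrier M" "b \<in> carrier M"
  then show "Box M (a \<sqinter> b) = Box M a \<sqinter> Box M b"
    using rep_eq_iff[of "Box M (a \<sqinter> b)" "Box M a \<sqinter> Box M b"]
    by (simp add: Box_closed rep_Box rep_meet interior_of_Int)
next
  fix a assume "a \<in> carrier M"
  then show "Box M a \<sqsubseteq> a" "Box M a \<sqsubseteq> Box M (Box M a)"
    by (simp_all add: rep_le Box_closed rep_Box interior_of_subset)
qed unfold_locales

lemma mt_opens_iff: "a \<in> mt_opens M \<longleftrightarrow> a \<in> carrier M \<and> openin X (r a)"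
proof -
  have "a = Box M a \<longleftrightarrow> openin X (r a)" if a: "a \<in> carrier M"
    unfolding rep_eq_iff[OF a Box_closed[OF a], symmetric] rep_Box[OF a]
    by (subst eq_commute) (rule Abstract_Topology.interior_of_eq)
  then show ?thesis unfolding mt_opens_def by blast
qed

lemma mt_closeds_iff: "a \<in> mt_closeds M \<longleftrightarrow> a \<in> carrier M \<and> closedin X (r a)"
proof -
  have "a = Dia M a \<longleftrightarrow> closedin X (r a)" if a: "a \<in> carrier M"
    unfolding rep_eq_iff[OF a Dia_closed[OF a], symmetric] rep_Dia[OF a]
    by (subst eq_commute) (rule Abstract_Topology.closure_of_eq)
  then show ?thesis unfolding mt_closeds_def by blast
qed

lemma mt_clopens_iff:
  "a \<in> mt_clopens M \<longleftrightarrow> a \<in> carrier M \<and> openin X (r a) \<and> closedin X (r a)"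
  by (auto simp: mt_clopens_def mt_opens_iff mt_closeds_iff)

lemma image_abs': "\<forall>U\<in>\<U>. U \<subseteq> topspace X \<Longrightarrow> abs ` \<U> \<subseteq> carrier M"
  and rep_image_abs': "\<forall>U\<in>\<U>. U \<subseteq> topspace X \<Longrightarrow> r ` abs ` \<U> = \<U>"
  using image_abs[of \<U>] rep_image_abs[of \<U>] by auto

lemma mt_compact_iff: "mt_compact M \<longleftrightarrow> compact_space X"
  unfolding mt_compact_def compact_space_iff
proof (intro iffI allI impI)
  fix \<U> assume c: "\<forall>S\<subseteq>mt_opens M. \<Squnion>S = \<top> \<longrightarrow> (\<exists>T\<subseteq>S. finite T \<and> \<Squnion>T = \<top>)"
    and "(\<forall>U\<in>\<U>. openin X U) \<and> \<Union>\<U> = topspace X"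
  then have U: "\<forall>U\<in>\<U>. openin X U" "\<Union>\<U> = topspace X" by auto
  then have U': "\<forall>U\<in>\<U>. U \<subseteq> topspace X" using openin_subset by blast
  have "abs ` \<U> \<subseteq> mt_opens M"
    using image_abs'[OF U'] U(1) U' rep_abs by (auto simp: mt_opens_iff)
  moreover have "\<Squnion>(abs ` \<U>) = \<top>"
    using sup_eq_top_iff[OF image_abs'[OF U']] rep_image_abs'[OF U'] U by simp
  ultimately obtain T where T: "T \<subseteq> abs ` \<U>" "finite T" "\<Squnion>T = \<top>"
    using c by blast
  then have "r ` T \<subseteq> \<U>" using image_mono[of T "abs ` \<U>" r] rep_image_abs'[OF U'] by simp
  moreover have "\<Union>(r ` T) = topspace X"
    using T(3) sup_eq_top_iff[OF subset_trans[OF T(1) image_abs'[OF U']]] by simp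
  ultimately show "\<exists>\<F>\<subseteq>\<U>. finite \<F> \<and> \<Union>\<F> = topspace X"
    using T(2) by (intro exI[of _ "r ` T"]) simp
next
  fix S assume c: "\<forall>\<U>. (\<forall>U\<in>\<U>. openin X U) \<and> \<Union>\<U> = topspace X \<longrightarrow>
        (\<exists>\<F>\<subseteq>\<U>. finite \<F> \<and> \<Union>\<F> = topspace X)"
    and S: "S \<subseteq> mt_opens M" "\<Squnion>S = \<top>"
  have S': "S \<subseteq> carrier M" using S by (auto simp: mt_opens_iff)
  have "\<forall>U\<in>r ` S. openin X U" "\<Union>(r ` S) = topspace X"
    using S S' mt_opens_iff sup_eq_top_iff[of S] by auto
  then obtain \<F> where F: "\<F> \<subseteq> r ` S" "finite \<F>" "\<Union>\<F> = topspace X"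
    using c[rule_format, of "r ` S"] by blast
  then obtain T where "T \<subseteq> S" "finite T" "\<F> = r ` T" by (meson finite_subset_image)
  moreover from this S' F have "\<Squnion>T = \<top>" using sup_eq_top_iff[of T] by simp
  ultimately show "\<exists>T\<subseteq>S. finite T \<and> \<Squnion>T = \<top>" by blast
qed

text \<open>If a singleton is a union of closed sets, one of them contains the point and is then
  equal to the singleton. Conversely, every set is the union of its singletons.\<close>

lemma mt_T1_iff: "mt_T1 M \<longleftrightarrow> t1_space X"
  unfolding t1_space_closedin_singleton
proof
  assume T1: "mt_T1 M"
  show "\<forall>x\<in>topspace X. closedin X {x}"
  proof
    fix x assume x: "x \<in> topspace X"
    then have o: "openin (discrete_topology (topspace X)) {x}" by simp
    obtain S where S: "S \<subseteq> mt_closeds M" "abs {x} = \<Squnion>S"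
      using T1 abs_closed[OF o] unfolding mt_T1_def by meson
    then have S': "S \<subseteq> carrier M" by (auto simp: mt_closeds_iff)
    then have e: "{x} = \<Union>(r ` S)"
      using S rep_sup[OF S'] rep_abs[OF o] by simp
    then obtain s where s: "s \<in> S" "x \<in> r s" by blast
    then have "r s \<subseteq> {x}" unfolding e by blast
    then have "r s = {x}" using s by blast
    then show "closedin X {x}" using s S mt_closeds_iff by (metis subsetD)
  qed
next
  assume T1: "\<forall>x\<in>topspace X. closedin X {x}"
  show "mt_T1 M" unfolding mt_T1_def
  proof
    fix a assume a: "a \<in> carrier M"
    let ?U = "(\<lambda>x. {x}) ` r a"
    have U: "\<forall>U\<in>?U. U \<subseteq> topspace X" using rep_subset[OF a] by auto
    have "abs ` ?U \<subseteq> mt_closeds M"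
      using U T1 by (auto simp: mt_closeds_iff abs_closed rep_abs)
    moreover have "a = \<Squnion>(abs ` ?U)"
      using eq_sup_iff[OF a image_abs'[OF U]] rep_image_abs'[OF U] by simp
    ultimately show "\<exists>S\<subseteq>mt_closeds M. a = \<Squnion>S" by blast
  qed
qed

lemma mt_zero_dimensional_iff:
  "mt_zero_dimensional M \<longleftrightarrow>
    t1_space X \<and> openin X = arbitrary union_of (\<lambda>U. openin X U \<and> closedin X U)"
proof -
  have sup: "a = \<Squnion>{c \<in> mt_clopens M. c \<sqsubseteq> a} \<longleftrightarrow>
      r a = \<Union>{C. openin X C \<and> closedin X C \<and> C \<subseteq> r a}" if a: "a \<in> carrier M" for a
  proof -
    have "r ` {c \<in> mt_clopens M. c \<sqsubseteq> a} = {C. openin X C \<and> closedin X C \<and> C \<subseteq> r a}"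
      (is "r ` ?A = ?B")
    proof
      show "r ` ?A \<subseteq> ?B" using a rep_le by (auto simp: mt_clopens_iff)
      show "?B \<subseteq> r ` ?A"
      proof
        fix C assume C: "C \<in> ?B"
        then have o: "openin (discrete_topology (topspace X)) C" using openin_subset by auto
        have "abs C \<in> ?A"
          using a C abs_closed[OF o] rep_abs[OF o] rep_le by (auto simp: mt_clopens_iff)
        then show "C \<in> r ` ?A" using rep_abs[OF o] by (metis imageI)
      qed
    qed
    moreover have "{c \<in> mt_clopens M. c \<sqsubseteq> a} \<subseteq> carrier M"
      by (auto simp: mt_clopens_iff)
    ultimately show ?thesis using a eq_sup_iff by simp
  qed
  have "(\<forall>a\<in>mt_opens M. a = \<Squnion>{b \<in> mt_clopens M. b \<sqsubseteq> a}) \<longleftrightarrow>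
      (\<forall>a\<in>mt_opens M. r a = \<Union>{C. openin X C \<and> closedin X C \<and> C \<subseteq> r a})"
    by (intro ball_cong refl sup) (simp_all add: mt_opens_iff)
  also have "\<dots> \<longleftrightarrow> (\<forall>U. openin X U \<longrightarrow> U = \<Union>{C. openin X C \<and> closedin X C \<and> C \<subseteq> U})"
  proof (intro iffI allI impI ballI)
    fix U assume *: "\<forall>a\<in>mt_opens M. r a = \<Union>{C. openin X C \<and> closedin X C \<and> C \<subseteq> r a}"
      and U: "openin X U"
    have o: "openin (discrete_topology (topspace X)) U" using openin_subset[OF U] by simp
    then have "abs U \<in> mt_opens M" using U by (simp add: mt_opens_iff abs_closed rep_abs)
    from bspec[OF * this] show "U = \<Union>{C. openin X C \<and> closedin X C \<and> C \<subseteq> U}"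
      unfolding rep_abs[OF o] .
  next
    fix a assume *: "\<forall>U. openin X U \<longrightarrow> U = \<Union>{C. openin X C \<and> closedin X C \<and> C \<subseteq> U}"
      and a: "a \<in> mt_opens M"
    show "r a = \<Union>{C. openin X C \<and> closedin X C \<and> C \<subseteq> r a}"
      by (rule *[rule_format]) (use a in \<open>simp add: mt_opens_iff\<close>)
  qed
  finally show ?thesis
    unfolding mt_zero_dimensional_def zero_dimensional_iff mt_T1_iff by simp
qed

text \<open>In a Hausdorff space a point x is the intersection of the closures of its open
  neighbourhoods, so singletons belong to \<open>mt_AC M\<close>, and every set is a union of
  singletons. Another point y is excluded by a neighbourhood V of x that is disjoint from a
  neighbourhood W of y, since then the closure of V misses y.\<close>

lemma mt_Hausdorff:
  assumes "Hausdorff_space X"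
  shows "mt_Hausdorff M"
  unfolding mt_Hausdorff_def
proof
  fix a assume a: "a \<in> carrier M"
  let ?U = "(\<lambda>x. {x}) ` r a"
  have U: "\<forall>U\<in>?U. U \<subseteq> topspace X" using rep_subset[OF a] by auto
  have "abs {x} \<in> mt_AC M" if x: "x \<in> topspace X" for x
  proof -
    have o: "openin (discrete_topology (topspace X)) {x}" using x by simp
    note abs_closed[OF o, simp] rep_abs[OF o, simp]
    let ?S = "{Dia M (Box M c) | c. c \<in> carrier M \<and> abs {x} \<sqsubseteq> Box M c}"
    have S: "?S \<subseteq> carrier M" by (auto simp: Dia_closed Box_closed)
    have "r (\<Sqinter>?S) = {x}"
    proof
      show "{x} \<subseteq> r (\<Sqinter>?S)"
      proof -
        have "x \<in> X closure_of (X interior_of r c)"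
          if "c \<in> carrier M" "abs {x} \<sqsubseteq> Box M c" for c
        proof -
          have "x \<in> X interior_of r c" using that by (simp add: rep_le Box_closed rep_Box)
          then show ?thesis
            by (rule subsetD[OF closure_of_subset[OF interior_of_subset_topspace]])
        qed
        then show ?thesis using x unfolding rep_inf[OF S] by (auto simp: rep_Dia Box_closed rep_Box)
      qed
      show "r (\<Sqinter>?S) \<subseteq> {x}"
      proof
        fix y assume y: "y \<in> r (\<Sqinter>?S)"
        then have yX: "y \<in> topspace X" unfolding rep_inf[OF S] by blast
        show "y \<in> {x}"
        proof (rule ccontr)
          assume "y \<notin> {x}"
          then obtain V W where VW: "openin X V" "openin X W" "x \<in> V" "y \<in> W" "disjnt V W"
            using assms x yX unfolding Hausdorff_space_def by (metis singletonI)
          have o': "openin (discrete_topology (topspace X)) V" using VW openin_subset by auto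
          have "abs {x} \<sqsubseteq> Box M (abs V)"
            using VW abs_closed[OF o'] rep_abs[OF o']
            by (simp add: rep_le Box_closed rep_Box interior_of_openin)
          then have "y \<in> r (Dia M (Box M (abs V)))"
            using y abs_closed[OF o'] unfolding rep_inf[OF S] by blast
          then have "y \<in> X closure_of V"
            using VW abs_closed[OF o'] rep_abs[OF o']
            by (simp add: rep_Dia Box_closed rep_Box interior_of_openin)
          then show False using VW unfolding in_closure_of disjnt_def by blast
        qed
      qed
    qed
    then have "r (abs {x}) = r (\<Sqinter>?S)" by (simp only: rep_abs[OF o])
    then have "abs {x} = \<Sqinter>?S" using rep_eq_iff[OF abs_closed[OF o] inf_closed[OF S]] by (rule iffD1[rotated])
    then show ?thesis unfolding mt_AC_def using abs_closed[OF o] by (intro CollectI conjI)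
  qed
  then have "abs ` ?U \<subseteq> mt_AC M" using rep_subset[OF a] by auto
  moreover have "a = \<Squnion>(abs ` ?U)"
    using eq_sup_iff[OF a image_abs'[OF U]] rep_image_abs'[OF U] by simp
  ultimately show "\<exists>S\<subseteq>mt_AC M. a = \<Squnion>S" by blast
qed

text \<open>From left to right, Hausdorffness of the space comes from T1 and the clopen basis. From
  right to left it supplies both \<open>mt_Hausdorff\<close> and the T1 part of
  zero-dimensionality.\<close>

lemma stone_mt_iff: "stone_mt M \<longleftrightarrow> stone_space X"
proof
  assume M: "stone_mt M"
  then have "t1_space X" and z: "openin X = arbitrary union_of (\<lambda>U. openin X U \<and> closedin X U)"
    unfolding stone_mt_def mt_zero_dimensional_iff by blast+
  from Hausdorff_if_t0_zero_dimensional[OF t1_imp_t0_space[OF this(1)] z] z M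
  show "stone_space X" unfolding stone_mt_def stone_space_def mt_compact_iff by (intro conjI) blast+
next
  assume X: "stone_space X"
  then have "Hausdorff_space X" unfolding stone_space_def by (elim conjE)
  with X mt_algebra mt_Hausdorff Hausdorff_imp_t1_space show "stone_mt M"
    unfolding stone_mt_def stone_space_def mt_compact_iff mt_zero_dimensional_iff
    by (intro conjI; (elim conjE)?; assumption?) simp_all
qed

text \<open>The singleton of any point in a represented atom lies below that atom, so by minimality
  atoms are singletons. This provides the bound in \<open>StoneMT_upto\<close>.\<close>

lemma atoms_lepoll: "mt_atoms M \<lesssim> topspace X"
proof -
  have "a \<in> (\<lambda>x. abs {x}) ` topspace X" if a: "a \<in> mt_atoms M" for a
  proof -
    have ac: "a \<in> carrier M" "a \<noteq> \<bottom>"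
      and min: "\<And>b. \<lbrakk>b \<in> carrier M; b \<sqsubseteq> a\<rbrakk> \<Longrightarrow> b = \<bottom> \<or> b = a"
      using a unfolding mt_atoms_def by blast+
    then have "r a \<noteq> {}" using rep_eq_iff[OF ac(1) bottom_closed] rep_bottom by simp
    then obtain x where x: "x \<in> r a" by blast
    then have xX: "x \<in> topspace X" using subsetD[OF rep_subset[OF ac(1)] x] by simp
    then have o: "openin (discrete_topology (topspace X)) {x}" by simp
    have "abs {x} \<sqsubseteq> a" using rep_le[OF abs_closed[OF o] ac(1)] x rep_abs[OF o] by simp
    moreover have "abs {x} \<noteq> \<bottom>"
    proof
      assume "abs {x} = \<bottom>"
      then have "r (abs {x}) = r \<bottom>" by (rule arg_cong)
      then show False unfolding rep_abs[OF o] rep_bottom by simp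
    qed
    ultimately have "a = abs {x}" using min[OF abs_closed[OF o]] by metis
    then show ?thesis using xX by (rule image_eqI)
  qed
  then have "mt_atoms M \<subseteq> (\<lambda>x. abs {x}) ` topspace X" by (rule subsetI)
  then show ?thesis by (rule lepoll_trans[OF subset_imp_lepoll image_lepoll])
qed

end

section \<open>Duality for morphisms\<close>

text \<open>Sobriety: P is a completely prime filter of open sets, and any point x outside the
  largest rejected set W determines it. Suppose an accepted U missed x. Each z in U has an open
  neighbourhood B disjoint from some open A around x; A is accepted because it is not inside W, and
  the empty set is rejected (apply \<open>un\<close> to the empty family), so B is rejected and z
  lies in W. Hence U is inside W, which is impossible for an accepted set.\<close>

lemma Hausdorff_completely_prime:
  assumes H: "Hausdorff_space X" and top: "P (topspace X)"
    and int: "\<And>U V. \<lbrakk>openin X U; openin X V\<rbrakk> \<Longrightarrow> P (U \<inter> V) \<longleftrightarrow> P U \<and> P V"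
    and un: "\<And>\<U>. (\<And>U. U \<in> \<U> \<Longrightarrow> openin X U) \<Longrightarrow> P (\<Union>\<U>) \<longleftrightarrow> (\<exists>U\<in>\<U>. P U)"
  shows "\<exists>x\<in>topspace X. \<forall>U. openin X U \<longrightarrow> P U \<longleftrightarrow> x \<in> U"
proof -
  define W where "W = \<Union>{V. openin X V \<and> \<not> P V}"
  have W: "openin X W" "\<not> P W" unfolding W_def using un[of "{V. openin X V \<and> \<not> P V}"] by auto
  have PI: "P U" if "openin X U" "\<not> U \<subseteq> W" for U using that unfolding W_def by blast
  have "W \<noteq> topspace X" using W top by auto
  then obtain x where x: "x \<in> topspace X" "x \<notin> W" using openin_subset[OF W(1)] by auto
  have "P U \<longleftrightarrow> x \<in> U" if U: "openin X U" for U
  proof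
    assume "x \<in> U" then show "P U" using PI[OF U] x by blast
  next
    assume PU: "P U"
    show "x \<in> U"
    proof (rule ccontr)
      assume xU: "x \<notin> U"
      have "z \<in> W" if z: "z \<in> U" for z
      proof -
        have "z \<in> topspace X" "z \<noteq> x" using z xU openin_subset[OF U] by auto
        then obtain A B where AB: "openin X A" "openin X B" "x \<in> A" "z \<in> B" "disjnt A B"
          using H x(1) unfolding Hausdorff_space_def by metis
        then have "P A" using PI[of A] x by blast
        moreover have "A \<inter> B = {}" using AB by (simp add: disjnt_def)
        moreover have "\<not> P {}" using un[of "{}"] by simp
        ultimately have "\<not> P B" using int[OF AB(1,2)] by simp
        then show ?thesis unfolding W_def using AB by blast
      qed
      then have "U \<inter> W = U" by blast
      then show False using int[OF U W(1)] PU W(2) by simp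
    qed
  qed
  then show ?thesis using x(1) by blast
qed

text \<open>Up to the representations, f is the preimage map of \<open>\<phi>\<close>. Only the
  underlying set of Y occurs, so the relation is unchanged when Y is replaced by the discrete space
  on the same points.\<close>

definition hom_rel ::
  "('b, 'e) gorder_scheme \<Rightarrow> ('b \<Rightarrow> 'a set) \<Rightarrow> 'c topology \<Rightarrow> ('d \<Rightarrow> 'c set) \<Rightarrow> ('b \<Rightarrow> 'd) \<Rightarrow>
    ('c \<Rightarrow> 'a) \<Rightarrow> bool" where
  "hom_rel L r Y s f \<phi> \<longleftrightarrow> (\<forall>a\<in>carrier L. s (f a) = {y \<in> topspace Y. \<phi> y \<in> r a})"

lemma hom_rel_id:
  assumes "\<And>a. a \<in> carrier L \<Longrightarrow> r a \<subseteq> topspace X"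
  shows "hom_rel L r X r (restrict id (carrier L)) (restrict id (topspace X))"
  using assms by (fastforce simp: hom_rel_def)

lemma hom_rel_compose:
  assumes "f \<in> carrier L \<rightarrow> carrier K" "\<psi> \<in> topspace Z \<rightarrow> topspace Y"
    and "hom_rel L r Y s f \<phi>" "hom_rel K s Z t g \<psi>"
  shows "hom_rel L r Z t (compose (carrier L) g f) (compose (topspace Z) \<phi> \<psi>)"
  unfolding hom_rel_def
proof
  fix a assume a: "a \<in> carrier L"
  then have "f a \<in> carrier K" using assms(1) by blast
  then have "t (g (f a)) = {z \<in> topspace Z. \<psi> z \<in> s (f a)}" using assms(4) by (simp add: hom_rel_def)
  also have "s (f a) = {y \<in> topspace Y. \<phi> y \<in> r a}" using assms(3) a by (simp add: hom_rel_def)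
  finally show "t (compose (carrier L) g f a) = {z \<in> topspace Z. compose (topspace Z) \<phi> \<psi> z \<in> r a}"
    using assms(2) a by (auto simp: compose_eq)
qed

text \<open>The space Y' of the relation is kept apart from the space Y of the representation: for
  MT-algebras the former is the Stone space and the latter is discrete.\<close>

lemma hom_rel_left_unique:
  assumes "frm_rep K Y s" "f \<in> carrier L \<rightarrow>\<^sub>E carrier K" "g \<in> carrier L \<rightarrow>\<^sub>E carrier K"
    and "hom_rel L r Y' s f \<phi>" "hom_rel L r Y' s g \<phi>"
  shows "f = g"
proof (rule PiE_ext[OF assms(2,3)])
  fix a assume a: "a \<in> carrier L"
  then have "s (f a) = s (g a)" using assms(4,5) by (simp add: hom_rel_def)
  then show "f a = g a"
    using frm_rep.rep_eq_iff[OF assms(1)] PiE_mem[OF assms(2) a] PiE_mem[OF assms(3) a] by blast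
qed

text \<open>If two maps differ at y, some open set tells the values apart; as it is a value of r,
  the two preimages would differ at y.\<close>

lemma hom_rel_right_unique:
  assumes "frm_rep L X r" "t0_space X"
    and \<phi>: "\<phi> \<in> topspace Y \<rightarrow>\<^sub>E topspace X" and \<psi>: "\<psi> \<in> topspace Y \<rightarrow>\<^sub>E topspace X"
    and "hom_rel L r Y s f \<phi>" "hom_rel L r Y s f \<psi>"
  shows "\<phi> = \<psi>"
proof (rule PiE_ext[OF \<phi> \<psi>], rule ccontr)
  interpret frm_rep L X r by fact
  fix y assume y: "y \<in> topspace Y" and ne: "\<phi> y \<noteq> \<psi> y"
  then obtain U where U: "openin X U" "\<phi> y \<notin> U \<longleftrightarrow> \<psi> y \<in> U"
    using assms(2) PiE_mem[OF \<phi> y] PiE_mem[OF \<psi> y] unfolding t0_space_def by metis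
  have "{z \<in> topspace Y. \<phi> z \<in> r (abs U)} = {z \<in> topspace Y. \<psi> z \<in> r (abs U)}"
    using assms(5,6) abs_closed[OF U(1)] unfolding hom_rel_def by metis
  then show False using U(2) y unfolding rep_abs[OF U(1)] by blast
qed

text \<open>For a point y, the open sets U with y in \<open>s (f (abs U))\<close> form a completely
  prime filter, since f preserves top, binary meets and all joins; \<open>\<phi> y\<close> is the
  point it determines. Continuity follows because the preimages of open sets are values of
  s.\<close>

lemma ex_dual_map:
  assumes "frm_rep L X r" "frm_rep K Y s" and H: "Hausdorff_space X"
    and f: "f \<in> carrier L \<rightarrow> carrier K" and top: "f \<top>\<^bsub>L\<^esub> = \<top>\<^bsub>K\<^esub>"
    and meet: "\<And>a b. \<lbrakk>a \<in> carrier L; b \<in> carrier L\<rbrakk> \<Longrightarrow> f (a \<sqinter>\<^bsub>L\<^esub> b) = f a \<sqinter>\<^bsub>K\<^esub> f b"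
    and sup: "\<And>S. S \<subseteq> carrier L \<Longrightarrow> f (\<Squnion>\<^bsub>L\<^esub>S) = \<Squnion>\<^bsub>K\<^esub>(f ` S)"
  shows "\<exists>\<phi>\<in>top_hom Y X. hom_rel L r Y s f \<phi>"
proof -
  interpret A: frm_rep L X r by fact
  interpret B: frm_rep K Y s by fact
  have fc: "f a \<in> carrier K" if "a \<in> carrier L" for a using f that by blast
  have "\<exists>x\<in>topspace X. \<forall>U. openin X U \<longrightarrow> y \<in> s (f (A.abs U)) \<longleftrightarrow> x \<in> U"
    if y: "y \<in> topspace Y" for y
  proof (rule Hausdorff_completely_prime[OF H])
    have "A.abs (topspace X) = \<top>\<^bsub>L\<^esub>"
      using A.abs_rep[OF A.top_closed] by (simp add: A.rep_top)
    then show "y \<in> s (f (A.abs (topspace X)))" using y by (simp add: top B.rep_top)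
  next
    fix U V assume UV: "openin X U" "openin X V"
    note c = A.abs_closed[OF UV(1)] A.abs_closed[OF UV(2)]
    have "A.abs (U \<inter> V) = A.abs U \<sqinter>\<^bsub>L\<^esub> A.abs V"
      using A.abs_rep[OF A.meet_closed[OF c]]
      unfolding A.rep_meet[OF c] A.rep_abs[OF UV(1)] A.rep_abs[OF UV(2)] .
    then show "y \<in> s (f (A.abs (U \<inter> V))) \<longleftrightarrow> y \<in> s (f (A.abs U)) \<and> y \<in> s (f (A.abs V))"
      by (simp add: meet[OF c] B.rep_meet[OF fc[OF c(1)] fc[OF c(2)]])
  next
    fix \<U> assume "\<And>U. U \<in> \<U> \<Longrightarrow> openin X U"
    then have U: "\<forall>U\<in>\<U>. openin X U" by blast
    note c = A.image_abs[OF U]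
    have "A.abs (\<Union>\<U>) = \<Squnion>\<^bsub>L\<^esub>(A.abs ` \<U>)"
      using A.abs_rep[OF A.sup_closed[OF c]] unfolding A.rep_sup[OF c] A.rep_image_abs[OF U] .
    moreover have "f ` A.abs ` \<U> \<subseteq> carrier K" using c fc by blast
    ultimately show "y \<in> s (f (A.abs (\<Union>\<U>))) \<longleftrightarrow> (\<exists>U\<in>\<U>. y \<in> s (f (A.abs U)))"
      by (simp add: sup[OF c] B.rep_sup)
  qed
  then obtain \<phi> where \<phi>: "\<And>y. y \<in> topspace Y \<Longrightarrow> \<phi> y \<in> topspace X"
    "\<And>y U. \<lbrakk>y \<in> topspace Y; openin X U\<rbrakk> \<Longrightarrow> y \<in> s (f (A.abs U)) \<longleftrightarrow> \<phi> y \<in> U" by metis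
  have eq: "s (f a) = {y \<in> topspace Y. \<phi> y \<in> r a}" if a: "a \<in> carrier L" for a
    using \<phi>(2)[OF _ A.openin_rep[OF a]] B.rep_subset[OF fc[OF a]] unfolding A.abs_rep[OF a] by blast
  have "continuous_map Y X \<phi>"
    unfolding continuous_map_def
  proof (intro conjI allI impI)
    show "\<phi> \<in> topspace Y \<rightarrow> topspace X" using \<phi>(1) by blast
    fix U assume U: "openin X U"
    show "openin Y {y \<in> topspace Y. \<phi> y \<in> U}"
      using B.openin_rep[OF fc[OF A.abs_closed[OF U]]]
      unfolding eq[OF A.abs_closed[OF U]] A.rep_abs[OF U] .
  qed
  then have "restrict \<phi> (topspace Y) \<in> top_hom Y X"
    by (auto simp: top_hom_def intro: continuous_map_eq)
  moreover have "hom_rel L r Y s f (restrict \<phi> (topspace Y))"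
    using eq by (auto simp: hom_rel_def)
  ultimately show ?thesis by blast
qed

lemma top_hom_PiE: "top_hom Y X \<subseteq> topspace Y \<rightarrow>\<^sub>E topspace X"
  by (auto simp: top_hom_def continuous_map_def PiE_def)

lemma ex_dual_frm_hom:
  assumes "frame_rep L X r" "frame_rep K Y s" and \<phi>: "\<phi> \<in> top_hom Y X"
  shows "\<exists>f\<in>frm_hom L K. hom_rel L r Y s f \<phi>"
proof -
  interpret A: frame_rep L X r by fact
  interpret B: frame_rep K Y s by fact
  define f where "f = (\<lambda>a\<in>carrier L. B.abs {y \<in> topspace Y. \<phi> y \<in> r a})"
  have o: "openin Y {y \<in> topspace Y. \<phi> y \<in> r a}" if "a \<in> carrier L" for a
    using \<phi> A.openin_rep[OF that] by (simp add: top_hom_def continuous_map_def)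
  have fc: "f a \<in> carrier K" and sf: "s (f a) = {y \<in> topspace Y. \<phi> y \<in> r a}"
    if "a \<in> carrier L" for a
    using B.abs_closed[OF o[OF that]] B.rep_abs[OF o[OF that]] that by (simp_all add: f_def)
  have "f \<in> frm_hom L K"
    unfolding frm_hom_def
  proof (intro CollectI conjI ballI allI impI)
    show "f \<in> carrier L \<rightarrow>\<^sub>E carrier K" using fc by (auto simp: f_def)
    have "s (f \<top>\<^bsub>L\<^esub>) = s \<top>\<^bsub>K\<^esub>"
      using subsetD[OF top_hom_PiE \<phi>] by (auto simp: sf A.rep_top B.rep_top)
    then show "f \<top>\<^bsub>L\<^esub> = \<top>\<^bsub>K\<^esub>" using B.rep_eq_iff fc by simp
  next
    fix a b assume ab: "a \<in> carrier L" "b \<in> carrier L"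
    have "s (f (a \<sqinter>\<^bsub>L\<^esub> b)) = s (f a \<sqinter>\<^bsub>K\<^esub> f b)"
      using ab fc by (auto simp: sf A.rep_meet B.rep_meet)
    then show "f (a \<sqinter>\<^bsub>L\<^esub> b) = f a \<sqinter>\<^bsub>K\<^esub> f b" using B.rep_eq_iff fc ab by simp
  next
    fix S assume S: "S \<subseteq> carrier L"
    have fS: "f ` S \<subseteq> carrier K" using S fc by blast
    have "s (f (\<Squnion>\<^bsub>L\<^esub>S)) = s (\<Squnion>\<^bsub>K\<^esub>(f ` S))"
      using S by (auto simp: sf A.rep_sup[OF S] B.rep_sup[OF fS] subset_iff)
    then show "f (\<Squnion>\<^bsub>L\<^esub>S) = \<Squnion>\<^bsub>K\<^esub>(f ` S)" using B.rep_eq_iff fc S fS by simp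
  qed
  then show ?thesis using sf by (auto simp: hom_rel_def)
qed

lemma ex_dual_mt_hom:
  assumes "mt_rep M X r" "mt_rep N Y s" and \<phi>: "\<phi> \<in> top_hom Y X"
  shows "\<exists>f\<in>mt_hom M N. hom_rel M r Y s f \<phi>"
proof -
  interpret A: mt_rep M X r by fact
  interpret B: mt_rep N Y s by fact
  define f where "f = (\<lambda>a\<in>carrier M. B.abs {y \<in> topspace Y. \<phi> y \<in> r a})"
  have o: "openin (discrete_topology (topspace Y)) {y \<in> topspace Y. \<phi> y \<in> r a}" for a
    by auto
  have fc: "f a \<in> carrier N" and sf: "s (f a) = {y \<in> topspace Y. \<phi> y \<in> r a}"
    if "a \<in> carrier M" for a
    using B.abs_closed[OF o] B.rep_abs[OF o] that by (simp_all add: f_def)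
  have \<phi>X: "\<phi> y \<in> topspace X" if "y \<in> topspace Y" for y
    using subsetD[OF top_hom_PiE \<phi>] that by blast
  have "f \<in> mt_hom M N"
    unfolding mt_hom_def
  proof (intro CollectI conjI ballI allI impI)
    show "f \<in> carrier M \<rightarrow>\<^sub>E carrier N" using fc by (auto simp: f_def)
  next
    fix S assume S: "S \<subseteq> carrier M"
    have fS: "f ` S \<subseteq> carrier N" using S fc by blast
    have "s (f (\<Squnion>\<^bsub>M\<^esub>S)) = s (\<Squnion>\<^bsub>N\<^esub>(f ` S))"
      using S by (auto simp: sf A.rep_sup[OF S] B.rep_sup[OF fS] subset_iff)
    then show "f (\<Squnion>\<^bsub>M\<^esub>S) = \<Squnion>\<^bsub>N\<^esub>(f ` S)" using B.rep_eq_iff fc S fS by simp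
    have "s (f (\<Sqinter>\<^bsub>M\<^esub>S)) = s (\<Sqinter>\<^bsub>N\<^esub>(f ` S))"
      using S \<phi>X by (auto simp: sf A.rep_inf[OF S] B.rep_inf[OF fS] subset_iff)
    then show "f (\<Sqinter>\<^bsub>M\<^esub>S) = \<Sqinter>\<^bsub>N\<^esub>(f ` S)" using B.rep_eq_iff fc S fS by simp
  next
    fix a assume a: "a \<in> carrier M"
    have "s (f (neg M a)) = s (neg N (f a))"
      using a fc \<phi>X by (auto simp: sf A.neg_closed A.rep_neg B.rep_neg)
    then show "f (neg M a) = neg N (f a)"
      using B.rep_eq_iff fc A.neg_closed B.neg_closed a by simp
    \<comment> \<open>By continuity the preimage of the interior is an open subset of the preimage
      of \<open>r a\<close>, hence inside its interior. In general there is no equality, which is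
      why morphisms satisfy only an inequality for \<open>Box\<close>.\<close>
    have "openin Y {y \<in> topspace Y. \<phi> y \<in> X interior_of r a}"
      using \<phi> by (simp add: top_hom_def continuous_map_def)
    moreover have "{y \<in> topspace Y. \<phi> y \<in> X interior_of r a} \<subseteq> {y \<in> topspace Y. \<phi> y \<in> r a}"
      using interior_of_subset[of X "r a"] by blast
    ultimately have "s (f (Box M a)) \<subseteq> s (Box N (f a))"
      using a fc by (simp add: sf A.Box_closed A.rep_Box B.rep_Box interior_of_maximal)
    then show "f (Box M a) \<sqsubseteq>\<^bsub>N\<^esub> Box N (f a)"
      using B.rep_le fc A.Box_closed B.Box_closed a by simp
  qed
  then show ?thesis using sf by (auto simp: hom_rel_def)
qed

text \<open>Without \<open>Box\<close>, f is a frame homomorphism between powersets, that is,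
  between the open sets of discrete and hence Hausdorff spaces; this yields the map of points.
  Preservation of top and of binary meets is read off from infima of the empty set and of pairs. The
  inequality for \<open>Box\<close> then makes the map continuous for the original
  topologies.\<close>

lemma ex_dual_map_mt:
  assumes "mt_rep M X r" "mt_rep N Y s" and f: "f \<in> mt_hom M N"
  shows "\<exists>\<phi>\<in>top_hom Y X. hom_rel M r Y s f \<phi>"
proof -
  interpret A: mt_rep M X r by fact
  interpret B: mt_rep N Y s by fact
  have fc: "f \<in> carrier M \<rightarrow>\<^sub>E carrier N" using f by (simp add: mt_hom_def)
  then have fc': "f a \<in> carrier N" if "a \<in> carrier M" for a using that by blast
  have inf: "f (\<Sqinter>\<^bsub>M\<^esub>S) = \<Sqinter>\<^bsub>N\<^esub>(f ` S)" if "S \<subseteq> carrier M" for S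
    using f that by (simp add: mt_hom_def)
  have "\<exists>\<phi>\<in>top_hom (discrete_topology (topspace Y)) (discrete_topology (topspace X)).
      hom_rel M r (discrete_topology (topspace Y)) s f \<phi>"
  proof (rule ex_dual_map[OF A.frm_rep_axioms B.frm_rep_axioms])
    have "\<top>\<^bsub>M\<^esub> = \<Sqinter>\<^bsub>M\<^esub>{}" "\<top>\<^bsub>N\<^esub> = \<Sqinter>\<^bsub>N\<^esub>{}"
      using A.rep_eq_iff[OF A.top_closed A.inf_closed[of "{}"]]
        B.rep_eq_iff[OF B.top_closed B.inf_closed[of "{}"]]
      by (simp_all add: A.rep_top B.rep_top A.rep_inf[of "{}"] B.rep_inf[of "{}"])
    then show "f \<top>\<^bsub>M\<^esub> = \<top>\<^bsub>N\<^esub>" using inf[of "{}"] by simp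
    show "f (a \<sqinter>\<^bsub>M\<^esub> b) = f a \<sqinter>\<^bsub>N\<^esub> f b" if "a \<in> carrier M" "b \<in> carrier M" for a b
      using inf[of "{a, b}"] that by (simp add: meet_def)
    show "f \<in> carrier M \<rightarrow> carrier N" using fc by blast
  qed (use f in \<open>auto simp: mt_hom_def\<close>)
  then obtain \<phi> where \<phi>: "\<phi> \<in> topspace Y \<rightarrow>\<^sub>E topspace X"
    and eq: "\<And>a. a \<in> carrier M \<Longrightarrow> s (f a) = {y \<in> topspace Y. \<phi> y \<in> r a}"
    using top_hom_PiE[of "discrete_topology (topspace Y)" "discrete_topology (topspace X)"]
    by (auto simp: hom_rel_def)
  have "continuous_map Y X \<phi>"
    unfolding continuous_map_def
  proof (intro conjI allI impI)
    fix U assume U: "openin X U"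
    then have o: "openin (discrete_topology (topspace X)) U" using openin_subset[OF U] by simp
    let ?a = "A.abs U"
    note a = A.abs_closed[OF o] and ra = A.rep_abs[OF o]
    \<comment> \<open>Since U is open, its element is fixed by \<open>Box\<close>; the morphism
      inequality puts the image below its own \<open>Box\<close>, so the preimage equals its
      interior.\<close>
    have "Box M ?a = ?a"
      using A.rep_eq_iff[OF A.Box_closed[OF a] a] U by (simp add: A.rep_Box[OF a] ra interior_of_openin)
    then have "f ?a \<sqsubseteq>\<^bsub>N\<^esub> Box N (f ?a)" using f a unfolding mt_hom_def by force
    then have "s (f ?a) \<subseteq> Y interior_of s (f ?a)"
      using B.rep_le[OF fc'[OF a] B.Box_closed[OF fc'[OF a]]] by (simp add: B.rep_Box[OF fc'[OF a]])
    then have "openin Y (s (f ?a))"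
      using interior_of_subset[of Y "s (f ?a)"] openin_interior_of[of Y "s (f ?a)"]
      by (metis subset_antisym)
    then show "openin Y {y \<in> topspace Y. \<phi> y \<in> U}" unfolding eq[OF a] ra .
  qed (use \<phi> in blast)
  then have "\<phi> \<in> top_hom Y X" using \<phi> by (simp add: top_hom_def PiE_def)
  then show ?thesis using eq by (auto simp: hom_rel_def)
qed

section \<open>Spaces of Stone frames and Stone MT-algebras\<close>

text \<open>The algebra has to live on a prescribed type, or inside a universe, so the powerset is
  transported along an injection e, and r undoes e.\<close>

lemma ex_mt_of_space:
  fixes X :: "'a topology" and e :: "'a set \<Rightarrow> 'b"
  assumes X: "stone_space X" and e: "inj_on e (Pow (topspace X))"
  shows "\<exists>M r. carrier M = e ` Pow (topspace X) \<and> stone_mt M \<and> mt_rep M X r"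
proof -
  define r where "r = inv_into (Pow (topspace X)) e"
  define M :: "'b mt" where "M = \<lparr>carrier = e ` Pow (topspace X), eq = (=),
    le = (\<lambda>a b. r a \<subseteq> r b), Box = (\<lambda>a. e (X interior_of r a))\<rparr>"
  have re: "r (e U) = U" if "U \<subseteq> topspace X" for U
    unfolding r_def using e that by (simp add: inv_into_f_f)
  have "frm_rep M (discrete_topology (topspace X)) r"
  proof (rule frm_repI)
    have "bij_betw r (e ` Pow (topspace X)) (Pow (topspace X))"
      unfolding r_def using e by (intro bij_betw_inv_into) (simp add: bij_betw_def)
    then show "bij_betw r (carrier M) {U. openin (discrete_topology (topspace X)) U}"
      by (simp add: M_def Pow_def)
  qed (simp_all add: M_def)
  then interpret frm_rep M "discrete_topology (topspace X)" r .
  interpret mt_rep M X r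
  proof unfold_locales
    fix a assume "a \<in> carrier M"
    show "Box M a \<in> carrier M" "r (Box M a) = X interior_of r a"
      by (simp_all add: M_def re interior_of_subset_topspace)
  qed
  have "stone_mt M" using X stone_mt_iff by simp
  moreover have "carrier M = e ` Pow (topspace X)" by (simp add: M_def)
  ultimately show ?thesis using mt_rep_axioms by blast
qed

lemma stone_space_Hausdorff: "stone_space X \<Longrightarrow> Hausdorff_space X"
  unfolding stone_space_def by (elim conjE)

lemma stone_space_t0: "stone_space X \<Longrightarrow> t0_space X"
  by (intro t1_imp_t0_space Hausdorff_imp_t1_space stone_space_Hausdorff)

lemma ex_frame_of_space:
  fixes X :: "'a topology" and e :: "'a set \<Rightarrow> 'b"
  assumes X: "stone_space X" and e: "inj_on e {U. openin X U}"
  shows "\<exists>L r. carrier L = e ` {U. openin X U} \<and> stone_frame L \<and> frame_rep L X r"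
proof -
  define r where "r = inv_into {U. openin X U} e"
  define L :: "'b gorder" where "L = \<lparr>carrier = e ` {U. openin X U}, eq = (=),
    le = (\<lambda>a b. r a \<subseteq> r b)\<rparr>"
  have "frm_rep L X r"
  proof (rule frm_repI)
    show "bij_betw r (carrier L) {U. openin X U}"
      unfolding r_def L_def partial_object.simps
      using e by (intro bij_betw_inv_into) (simp add: bij_betw_def)
  qed (simp_all add: L_def)
  then interpret frm_rep L X r .
  interpret frame_rep L X r ..
  have "stone_frame L" using X stone_frame_iff[OF stone_space_t0] by simp
  moreover have "carrier L = e ` {U. openin X U}" by (simp add: L_def)
  ultimately show ?thesis using frame_rep_axioms by blast
qed

text \<open>Zorn's lemma for the members of Q above a other than top. A chain of them cannot have
  supremum top: a finite part would already reach it, yet a nonempty finite part of a chain has a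
  greatest member. The parameter Q is the whole carrier for frames and the set of open elements for
  MT-algebras.\<close>

lemma (in complete_lattice) ex_maximal_below_top:
  assumes Q: "Q \<subseteq> carrier L" and sup: "\<And>S. S \<subseteq> Q \<Longrightarrow> \<Squnion>S \<in> Q"
    and compact: "\<And>S. \<lbrakk>S \<subseteq> Q; \<Squnion>S = \<top>\<rbrakk> \<Longrightarrow> \<exists>T\<subseteq>S. finite T \<and> \<Squnion>T = \<top>"
    and a: "a \<in> Q" "a \<noteq> \<top>"
  shows "\<exists>m\<in>Q. a \<sqsubseteq> m \<and> m \<noteq> \<top> \<and> (\<forall>b\<in>Q. m \<sqsubseteq> b \<longrightarrow> b = \<top> \<or> b = m)"
proof -
  have anti: "x = y" if "x \<sqsubseteq> y" "y \<sqsubseteq> x" "x \<in> carrier L" "y \<in> carrier L" for x y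
    using weak_le_antisym[OF that] by (simp add: eq_is_equal)
  define A where "A = {b \<in> Q. a \<sqsubseteq> b \<and> b \<noteq> \<top>}"
  have Ac: "x \<in> carrier L" if "x \<in> A" for x using that Q by (auto simp: A_def)
  have "\<exists>m\<in>A. \<forall>x\<in>A. m \<sqsubseteq> x \<longrightarrow> x = m"
  proof (rule predicate_Zorn)
    show "partial_order_on A (relation_of (\<sqsubseteq>) A)"
    proof (rule partial_order_on_relation_ofI)
      show "x \<sqsubseteq> z" if "x \<in> A" "y \<in> A" "z \<in> A" "x \<sqsubseteq> y" "y \<sqsubseteq> z" for x y z
        using le_trans[OF that(4,5) Ac[OF that(1)] Ac[OF that(2)] Ac[OF that(3)]] .
      show "x = y" if "x \<in> A" "y \<in> A" "x \<sqsubseteq> y" "y \<sqsubseteq> x" for x y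
        using anti[OF that(3,4) Ac[OF that(1)] Ac[OF that(2)]] .
    qed (simp add: Ac)
  next
    fix C assume "C \<in> Chains (relation_of (\<sqsubseteq>) A)"
    then have CA: "C \<subseteq> A" and chain: "\<And>x y. \<lbrakk>x \<in> C; y \<in> C\<rbrakk> \<Longrightarrow> x \<sqsubseteq> y \<or> y \<sqsubseteq> x"
      by (auto simp: Chains_def relation_of_def)
    show "\<exists>u\<in>A. \<forall>x\<in>C. x \<sqsubseteq> u"
    proof (cases "C = {}")
      case True
      have "a \<in> A" using a Q by (auto simp: A_def)
      then show ?thesis using True by blast
    next
      case False
      have CQ: "C \<subseteq> Q" using CA by (auto simp: A_def)
      have Cc: "C \<subseteq> carrier L" using CA Ac by blast
      have fin: "\<exists>t\<in>T. \<forall>s\<in>T. s \<sqsubseteq> t" if "finite T" "T \<noteq> {}" "T \<subseteq> C" for T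
        using that
      proof (induction rule: finite_ne_induct)
        case (singleton x) then show ?case using Cc by auto
      next
        case (insert x F)
        then obtain t where t: "t \<in> F" "\<forall>s\<in>F. s \<sqsubseteq> t" by auto
        have c: "x \<in> carrier L" "t \<in> carrier L" "F \<subseteq> carrier L" using insert t Cc by auto
        from chain[of x t] insert t have "x \<sqsubseteq> t \<or> t \<sqsubseteq> x" by auto
        then show ?case
        proof
          assume "x \<sqsubseteq> t" then show ?thesis using t by blast
        next
          assume "t \<sqsubseteq> x"
          have "s \<sqsubseteq> x" if "s \<in> F" for s
            using le_trans[of s t x] \<open>t \<sqsubseteq> x\<close> t c that by blast
          then show ?thesis using c by auto
        qed
      qed
      have "\<Squnion>C \<noteq> \<top>"
      proof
        assume "\<Squnion>C = \<top>"
        then obtain T where T: "T \<subseteq> C" "finite T" "\<Squnion>T = \<top>" using compact[OF CQ] by blast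
        have Tc: "T \<subseteq> carrier L" using T(1) Cc by blast
        have "\<exists>t\<in>A. \<forall>s\<in>T. s \<sqsubseteq> t"
        proof (cases "T = {}")
          \<comment> \<open>A finite subfamily with join top may be empty; any member of the
            nonempty chain then serves as its bound.\<close>
          case True
          then show ?thesis using \<open>C \<noteq> {}\<close> CA by blast
        next
          case False
          then show ?thesis using fin[OF T(2) False T(1)] T(1) CA by blast
        qed
        then obtain t where t: "t \<in> A" "\<forall>s\<in>T. s \<sqsubseteq> t" by blast
        have tc: "t \<in> carrier L" by (rule Ac[OF t(1)])
        have "\<Squnion>T \<sqsubseteq> t" by (rule weak.sup_least[OF Tc tc]) (use t in blast)
        then have "t = \<top>" using anti[of t "\<top>"] tc T(3) top_higher[OF tc] by simp
        then show False using t(1) by (simp add: A_def)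
      qed
      moreover have "a \<sqsubseteq> \<Squnion>C"
      proof -
        obtain x where x: "x \<in> C" using False by blast
        then have "a \<sqsubseteq> x" "x \<in> carrier L" using CA Cc by (auto simp: A_def)
        then show ?thesis
          using le_trans[OF _ sup_upper[OF Cc x]] subsetD[OF Q a(1)] sup_closed[OF Cc] by blast
      qed
      ultimately have "\<Squnion>C \<in> A" using sup[OF CQ] by (simp add: A_def)
      then show ?thesis using sup_upper[OF Cc] by blast
    qed
  qed
  then obtain m where m: "m \<in> A" "\<forall>x\<in>A. m \<sqsubseteq> x \<longrightarrow> x = m" by blast
  have "b = \<top> \<or> b = m" if b: "b \<in> Q" "m \<sqsubseteq> b" for b
  proof -
    have "a \<sqsubseteq> b" using le_trans[of a m b] m(1) b a Q by (auto simp: A_def)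
    then show ?thesis using m(2) b by (auto simp: A_def)
  qed
  then show ?thesis using m(1) by (auto simp: A_def)
qed

text \<open>Among the open sets of a T1 space these are exactly the complements of points, which
  makes them the candidates for the points of the space.\<close>

definition frm_coatoms :: "'a gorder \<Rightarrow> 'a set" where
  "frm_coatoms L = {p \<in> carrier L. p \<noteq> \<top>\<^bsub>L\<^esub> \<and>
     (\<forall>b\<in>carrier L. p \<sqsubseteq>\<^bsub>L\<^esub> b \<longrightarrow> b = \<top>\<^bsub>L\<^esub> \<or> b = p)}"

section \<open>The space of coatoms of a Stone frame\<close>

locale stone_frm = complete_lattice L for L :: "'b gorder" (structure) +
  assumes stone: "stone_frame L"
begin

lemma le_antisym: "\<lbrakk>x \<sqsubseteq> y; y \<sqsubseteq> x; x \<in> carrier L; y \<in> carrier L\<rbrakk> \<Longrightarrow> x = y"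
  using weak_le_antisym[of x y] by (simp add: eq_is_equal)

lemma meet_sup:
  "\<lbrakk>a \<in> carrier L; S \<subseteq> carrier L\<rbrakk> \<Longrightarrow> a \<sqinter> \<Squnion>S = \<Squnion>((\<lambda>s. a \<sqinter> s) ` S)"
  using stone unfolding stone_frame_def is_frame_def by blast

lemma meet_join:
  assumes "a \<in> carrier L" "b \<in> carrier L" "c \<in> carrier L"
  shows "a \<sqinter> (b \<squnion> c) = (a \<sqinter> b) \<squnion> (a \<sqinter> c)"
  using meet_sup[of a "{b, c}"] assms by (simp add: join_def)

lemma frm_coatoms_closed: "p \<in> frm_coatoms L \<Longrightarrow> p \<in> carrier L"
  and frm_coatoms_ne: "p \<in> frm_coatoms L \<Longrightarrow> p \<noteq> \<top>"
  and frm_coatoms_max: "\<lbrakk>p \<in> frm_coatoms L; b \<in> carrier L; p \<sqsubseteq> b\<rbrakk> \<Longrightarrow> b = \<top> \<or> b = p"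
  unfolding frm_coatoms_def by blast+

lemma frm_coatoms_join:
  assumes p: "p \<in> frm_coatoms L" and a: "a \<in> carrier L" "\<not> a \<sqsubseteq> p"
  shows "a \<squnion> p = \<top>"
proof -
  note pc = frm_coatoms_closed[OF p]
  have "a \<squnion> p = \<top> \<or> a \<squnion> p = p"
    using a pc by (intro frm_coatoms_max[OF p]) (simp_all add: join_right)
  then show ?thesis using a join_left[OF a(1) pc] by auto
qed

text \<open>If neither element lies below p, then b joins with p to top, and distributivity writes a
  as the join of \<open>a \<sqinter> b\<close> and \<open>a \<sqinter> p\<close>, both below
  p.\<close>

lemma frm_coatoms_prime:
  assumes p: "p \<in> frm_coatoms L" and ab: "a \<in> carrier L" "b \<in> carrier L" "a \<sqinter> b \<sqsubseteq> p"
  shows "a \<sqsubseteq> p \<or> b \<sqsubseteq> p"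
proof (rule ccontr)
  note pc = frm_coatoms_closed[OF p]
  assume "\<not> ?thesis"
  then have n: "\<not> a \<sqsubseteq> p" and "b \<squnion> p = \<top>" using frm_coatoms_join[OF p ab(2)] by auto
  then have "a \<sqinter> \<top> = (a \<sqinter> b) \<squnion> (a \<sqinter> p)" using meet_join[OF ab(1,2) pc] by simp
  also have "\<dots> \<sqsubseteq> p" using ab pc by (intro join_le) (simp_all add: meet_right)
  finally have "a \<sqinter> \<top> \<sqsubseteq> p" .
  moreover have "a \<sqsubseteq> a \<sqinter> \<top>" using ab(1) by (intro meet_le) (simp_all add: top_higher)
  ultimately show False using n le_trans[of a "a \<sqinter> \<top>" p] ab(1) pc by simp
qed

lemma ex_frm_coatom_above:
  assumes a: "a \<in> carrier L" "a \<noteq> \<top>"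
  shows "\<exists>p\<in>frm_coatoms L. a \<sqsubseteq> p"
proof -
  have "\<exists>m\<in>carrier L. a \<sqsubseteq> m \<and> m \<noteq> \<top> \<and> (\<forall>b\<in>carrier L. m \<sqsubseteq> b \<longrightarrow> b = \<top> \<or> b = m)"
    by (rule ex_maximal_below_top)
      (use a stone in \<open>auto simp: stone_frame_def frm_compact_def\<close>)
  then show ?thesis unfolding frm_coatoms_def by blast
qed

lemma frm_complemented_meet:
  assumes c: "c \<in> frm_complemented L"
  shows "c \<sqinter> pseudocomplement L c \<sqsubseteq> \<bottom>"
proof -
  let ?P = "{x \<in> carrier L. x \<sqinter> c = \<bottom>}"
  have cc: "c \<in> carrier L" using c by (simp add: frm_complemented_def)
  have "c \<sqinter> \<Squnion>?P = \<Squnion>((\<lambda>s. c \<sqinter> s) ` ?P)" using cc by (intro meet_sup) auto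
  also have "\<dots> \<sqsubseteq> \<bottom>"
    using cc meet_comm[of L c] by (intro sup_least) auto
  finally show ?thesis by (simp add: pseudocomplement_def)
qed

text \<open>Spatiality. Zero-dimensionality gives a complemented c below a but not below b. The join
  of b with the pseudocomplement of c is not top, since meeting with c would put c below b. A coatom
  above this join is not above c, as c and its pseudocomplement join to top; so it is not above
  a.\<close>

lemma frm_coatoms_separate:
  assumes a: "a \<in> carrier L" and b: "b \<in> carrier L" and n: "\<not> a \<sqsubseteq> b"
  shows "\<exists>p\<in>frm_coatoms L. b \<sqsubseteq> p \<and> \<not> a \<sqsubseteq> p"
proof -
  let ?C = "{c \<in> frm_complemented L. c \<sqsubseteq> a}"
  have C: "?C \<subseteq> carrier L" by (auto simp: frm_complemented_def)
  have aC: "a = \<Squnion>?C"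
    using stone a unfolding stone_frame_def frm_zero_dimensional_def by blast
  have "\<exists>c\<in>?C. \<not> c \<sqsubseteq> b"
  proof (rule ccontr)
    assume "\<not> ?thesis"
    then have "\<Squnion>?C \<sqsubseteq> b" by (intro sup_least[OF C b]) blast
    with aC n show False by (simp only: aC[symmetric])
  qed
  then obtain c where c: "c \<in> frm_complemented L" "c \<sqsubseteq> a" "\<not> c \<sqsubseteq> b" by blast
  let ?d = "pseudocomplement L c"
  have cc: "c \<in> carrier L" and cd: "c \<squnion> ?d = \<top>" using c by (auto simp: frm_complemented_def)
  have dc: "?d \<in> carrier L" unfolding pseudocomplement_def by (intro sup_closed) auto
  have "?d \<squnion> b \<noteq> \<top>"
  proof
    assume "?d \<squnion> b = \<top>"
    then have "c \<sqinter> \<top> = (c \<sqinter> ?d) \<squnion> (c \<sqinter> b)" using meet_join[OF cc dc b] by simp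
    also have "\<dots> \<sqsubseteq> b"
    proof (rule join_le)
      show "c \<sqinter> ?d \<sqsubseteq> b"
        using le_trans[OF frm_complemented_meet[OF c(1)] bottom_lower[OF b]] cc dc b by simp
    qed (use cc dc b in \<open>simp_all add: meet_right\<close>)
    finally have "c \<sqinter> \<top> \<sqsubseteq> b" .
    moreover have "c \<sqsubseteq> c \<sqinter> \<top>" using cc by (intro meet_le) (simp_all add: top_higher)
    ultimately show False using c(3) le_trans[of c "c \<sqinter> \<top>" b] cc b by simp
  qed
  then obtain p where p: "p \<in> frm_coatoms L" "?d \<squnion> b \<sqsubseteq> p"
    using ex_frm_coatom_above[of "?d \<squnion> b"] dc b by auto
  note pc = frm_coatoms_closed[OF p(1)]
  have "?d \<sqsubseteq> p" "b \<sqsubseteq> p"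
    using le_trans[OF join_left[OF dc b] p(2)] le_trans[OF join_right[OF dc b] p(2)] dc b pc by auto
  moreover have "\<not> a \<sqsubseteq> p"
  proof
    assume "a \<sqsubseteq> p"
    then have "c \<sqsubseteq> p" using le_trans[OF c(2)] cc a pc by blast
    then have "\<top> \<sqsubseteq> p" using join_le[OF _ \<open>?d \<sqsubseteq> p\<close>] cc dc pc cd by metis
    then have "p = \<top>" using le_antisym[of p "\<top>"] top_higher pc by simp
    then show False using frm_coatoms_ne[OF p(1)] by simp
  qed
  ultimately show ?thesis using p by blast
qed

text \<open>An element goes to the set of coatoms not above it. Primality turns meets into
  intersections, joins become unions by the least upper bound property, and separation makes the map
  an order embedding; so its values form a topology and not merely a base. T0 holds because distinct
  coatoms are incomparable. The relabelling i allows the space to live on another type.\<close>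

lemma ex_space:
  fixes i :: "'b \<Rightarrow> 'a"
  assumes i: "inj_on i (frm_coatoms L)"
  shows "\<exists>X r. topspace X = i ` frm_coatoms L \<and> stone_space X \<and> frame_rep L X r"
proof -
  define r where "r a = i ` {p \<in> frm_coatoms L. \<not> a \<sqsubseteq> p}" for a
  have mem: "i p \<in> r a \<longleftrightarrow> \<not> a \<sqsubseteq> p" if "p \<in> frm_coatoms L" for p a
    using that i by (auto simp: r_def inj_on_def)
  have le: "a \<sqsubseteq> b \<longleftrightarrow> r a \<subseteq> r b" if ab: "a \<in> carrier L" "b \<in> carrier L" for a b
  proof
    assume le: "a \<sqsubseteq> b"
    show "r a \<subseteq> r b"
      unfolding r_def
    proof (rule image_mono, rule subsetI)
      fix p assume "p \<in> {p \<in> frm_coatoms L. \<not> a \<sqsubseteq> p}"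
      then show "p \<in> {p \<in> frm_coatoms L. \<not> b \<sqsubseteq> p}"
        using le_trans[OF le _ ab, of p] frm_coatoms_closed[of p] by blast
    qed
  next
    assume s: "r a \<subseteq> r b"
    show "a \<sqsubseteq> b"
    proof (rule ccontr)
      assume "\<not> a \<sqsubseteq> b"
      then obtain p where p: "p \<in> frm_coatoms L" "b \<sqsubseteq> p" "\<not> a \<sqsubseteq> p"
        using frm_coatoms_separate[OF ab] by blast
      then show False using subsetD[OF s, of "i p"] unfolding mem[OF p(1)] by blast
    qed
  qed
  have rmeet: "r (a \<sqinter> b) = r a \<inter> r b" if ab: "a \<in> carrier L" "b \<in> carrier L" for a b
  proof -
    have "a \<sqinter> b \<sqsubseteq> p \<longleftrightarrow> a \<sqsubseteq> p \<or> b \<sqsubseteq> p" if p: "p \<in> frm_coatoms L" for p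
      using frm_coatoms_prime[OF p ab] le_trans[OF meet_left[OF ab], of p]
        le_trans[OF meet_right[OF ab], of p] ab frm_coatoms_closed[OF p] by auto
    then have "{p \<in> frm_coatoms L. \<not> a \<sqinter> b \<sqsubseteq> p}
        = {p \<in> frm_coatoms L. \<not> a \<sqsubseteq> p} \<inter> {p \<in> frm_coatoms L. \<not> b \<sqsubseteq> p}" by blast
    then show ?thesis
      unfolding r_def using inj_on_image_Int[OF i, of "{p \<in> frm_coatoms L. \<not> a \<sqsubseteq> p}"
        "{p \<in> frm_coatoms L. \<not> b \<sqsubseteq> p}"] by auto
  qed
  have rsup: "r (\<Squnion>S) = \<Union>(r ` S)" if S: "S \<subseteq> carrier L" for S
  proof -
    have key: "\<Squnion>S \<sqsubseteq> p \<longleftrightarrow> (\<forall>s\<in>S. s \<sqsubseteq> p)" if p: "p \<in> frm_coatoms L" for p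
    proof
      assume le: "\<Squnion>S \<sqsubseteq> p"
      show "\<forall>s\<in>S. s \<sqsubseteq> p"
      proof
        fix s assume s: "s \<in> S"
        show "s \<sqsubseteq> p"
          by (rule le_trans[OF sup_upper[OF S s] le])
            (use s S sup_closed[OF S] frm_coatoms_closed[OF p] in auto)
      qed
    next
      assume le: "\<forall>s\<in>S. s \<sqsubseteq> p"
      show "\<Squnion>S \<sqsubseteq> p"
      proof (rule sup_least[OF S frm_coatoms_closed[OF p]])
        fix s assume "s \<in> S"
        with le show "s \<sqsubseteq> p" by (rule bspec)
      qed
    qed
    have "{p \<in> frm_coatoms L. \<not> \<Squnion>S \<sqsubseteq> p} = (\<Union>s\<in>S. {p \<in> frm_coatoms L. \<not> s \<sqsubseteq> p})"
      by (intro Set.set_eqI) (auto simp: key cong: conj_cong)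
    then have "r (\<Squnion>S) = i ` (\<Union>s\<in>S. {p \<in> frm_coatoms L. \<not> s \<sqsubseteq> p})" by (simp only: r_def)
    also have "\<dots> = (\<Union>s\<in>S. i ` {p \<in> frm_coatoms L. \<not> s \<sqsubseteq> p})" by (rule image_UN)
    also have "\<dots> = \<Union>(r ` S)" by (rule SUP_cong[OF HOL.refl]) (simp only: r_def)
    finally show ?thesis .
  qed
  have "istopology (\<lambda>U. U \<in> r ` carrier L)"
    unfolding istopology_def
  proof (intro conjI allI impI)
    fix U V assume "U \<in> r ` carrier L" "V \<in> r ` carrier L"
    then obtain a b where ab: "a \<in> carrier L" "b \<in> carrier L" "U = r a" "V = r b" by blast
    show "U \<inter> V \<in> r ` carrier L"
      unfolding ab(3,4) rmeet[OF ab(1,2), symmetric] by (intro imageI meet_closed ab)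
  next
    fix \<U> assume "\<forall>U\<in>\<U>. U \<in> r ` carrier L"
    then have "\<U> \<subseteq> r ` carrier L" by blast
    then obtain S where S: "S \<subseteq> carrier L" "\<U> = r ` S" unfolding subset_image_iff by blast
    show "\<Union>\<U> \<in> r ` carrier L"
      unfolding S(2) rsup[OF S(1), symmetric] by (intro imageI sup_closed S)
  qed
  from fun_cong[OF topology_inverse'[OF this]]
  obtain X where X: "\<And>U. openin X U \<longleftrightarrow> U \<in> r ` carrier L" by (rule that)
  have eq: "a = b" if "a \<in> carrier L" "b \<in> carrier L" "r a = r b" for a b
    using le_antisym[of a b] le[of a b] le[of b a] that by simp
  have "bij_betw r (carrier L) {U. openin X U}"
    unfolding bij_betw_def X by (intro conjI inj_onI eq) simp_all
  then interpret frame_rep L X r by unfold_locales (assumption, rule le)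
  have top: "topspace X = i ` frm_coatoms L"
  proof -
    have "\<not> \<top> \<sqsubseteq> p" if p: "p \<in> frm_coatoms L" for p
      using le_antisym[of p "\<top>"] top_higher frm_coatoms_closed[OF p] frm_coatoms_ne[OF p] by auto
    then show ?thesis unfolding rep_top[symmetric] by (auto simp: r_def)
  qed
  have "t0_space X"
    unfolding t0_space_def top
  proof (clarsimp)
    fix p q assume pq: "p \<in> frm_coatoms L" "q \<in> frm_coatoms L" "i p \<noteq> i q"
    note pc = frm_coatoms_closed[OF pq(1)]
    have "\<not> p \<sqsubseteq> q"
      using frm_coatoms_max[OF pq(1) frm_coatoms_closed[OF pq(2)]] frm_coatoms_ne[OF pq(2)] pq(3) by auto
    then have "i q \<in> r p" "i p \<notin> r p" using mem pq pc by auto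
    then show "\<exists>U. openin X U \<and> (i p \<notin> U \<longleftrightarrow> i q \<in> U)" using openin_rep[OF pc] by blast
  qed
  then have "stone_space X" using stone stone_frame_iff by blast
  then show ?thesis using top frame_rep_axioms by blast
qed

end

text \<open>The two-element frame is the frame of open sets of a one-point space, so its duality
  with continuous maps identifies \<open>frm_points L\<close> with the points of X. This connects
  the bound in \<open>StoneFrm_upto\<close> with the coatoms.\<close>

lemma frm_points_eqpoll:
  assumes "frame_rep L X r" and H: "Hausdorff_space X"
  shows "frm_points L \<approx> topspace X"
proof -
  interpret frame_rep L X r by fact
  let ?D = "discrete_topology (UNIV :: unit set)"
  define s :: "bool \<Rightarrow> unit set" where "s b = (if b then UNIV else {})" for b
  let ?two = "\<lparr>carrier = UNIV, eq = (=), le = (\<le>)\<rparr> :: bool gorder"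
  have "frm_rep ?two ?D s"
  proof (rule frm_repI)
    have "inj s" by (rule injI) (simp add: s_def split: if_splits)
    moreover have "U \<in> range s" for U
    proof (cases "U = {}")
      case True then show ?thesis by (intro image_eqI[of _ _ False]) (simp_all add: s_def)
    next
      case False
      then have "U = UNIV" by auto
      then show ?thesis by (intro image_eqI[of _ _ True]) (simp_all add: s_def)
    qed
    ultimately have "bij_betw s UNIV UNIV" by (intro bij_betw_imageI) blast+
    then show "bij_betw s (carrier ?two) {U. openin ?D U}" by simp
  qed (auto simp: s_def)
  then interpret two: frame_rep ?two ?D s by (simp add: frame_rep_def)
  have rel: "hom_rel L r ?D s f \<phi> \<longleftrightarrow> (\<forall>a\<in>carrier L. f a \<longleftrightarrow> \<phi> () \<in> r a)" for f \<phi>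
    by (auto simp: hom_rel_def s_def)
  have "\<exists>x\<in>topspace X. \<forall>a\<in>carrier L. f a \<longleftrightarrow> x \<in> r a" if f: "f \<in> frm_points L" for f
  proof -
    have "\<exists>\<phi>\<in>top_hom ?D X. hom_rel L r ?D s f \<phi>"
      by (rule ex_dual_map[OF frm_rep_axioms two.frm_rep_axioms H])
        (use f in \<open>auto simp: frm_points_def frm_hom_def\<close>)
    then show ?thesis unfolding rel using top_hom_PiE[of ?D X] by auto
  qed
  then obtain g where g: "\<And>f. f \<in> frm_points L \<Longrightarrow> g f \<in> topspace X"
    "\<And>f a. \<lbrakk>f \<in> frm_points L; a \<in> carrier L\<rbrakk> \<Longrightarrow> f a \<longleftrightarrow> g f \<in> r a" by metis
  have "bij_betw g (frm_points L) (topspace X)"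
    unfolding bij_betw_def
  proof
    show "inj_on g (frm_points L)"
    proof (rule inj_onI)
      fix f f' assume f: "f \<in> frm_points L" "f' \<in> frm_points L" "g f = g f'"
      then have "f \<in> carrier L \<rightarrow>\<^sub>E UNIV" "f' \<in> carrier L \<rightarrow>\<^sub>E UNIV"
        by (auto simp: frm_points_def frm_hom_def)
      then show "f = f'" by (rule PiE_ext) (simp add: g(2)[OF f(1)] g(2)[OF f(2)] f(3))
    qed
    show "g ` frm_points L = topspace X"
    proof
      show "topspace X \<subseteq> g ` frm_points L"
      proof
        fix x assume x: "x \<in> topspace X"
        then have "(\<lambda>_. x) \<in> top_hom ?D X" by (simp add: top_hom_def)
        then obtain f where f: "f \<in> frm_points L" "hom_rel L r ?D s f (\<lambda>_. x)"
          using ex_dual_frm_hom[OF frame_rep_axioms two.frame_rep_axioms]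
          unfolding frm_points_def by blast
        have "g f = x"
        proof (rule ccontr)
          assume "g f \<noteq> x"
          then obtain U where U: "openin X U" "g f \<in> U" "x \<notin> U"
            using H g(1)[OF f(1)] x unfolding Hausdorff_space_def disjnt_iff by metis
          then show False
            using f(2) g(2)[OF f(1) abs_closed[OF U(1)]] abs_closed[OF U(1)] rep_abs[OF U(1)]
            unfolding rel by simp
        qed
        then show "x \<in> g ` frm_points L" using f by blast
      qed
    qed (use g in blast)
  qed
  then show ?thesis unfolding eqpoll_def by blast
qed

section \<open>Calculus of negation, interior and atoms in an MT-algebra\<close>

locale mt_alg = complete_lattice M for M :: "'b mt" (structure) +
  assumes alg: "mt_algebra M"
begin

lemma le_antisym: "\<lbrakk>x \<sqsubseteq> y; y \<sqsubseteq> x; x \<in> carrier M; y \<in> carrier M\<rbrakk> \<Longrightarrow> x = y"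
  using weak_le_antisym[of x y] by (simp add: eq_is_equal)

lemma le_bottom: "\<lbrakk>x \<sqsubseteq> \<bottom>; x \<in> carrier M\<rbrakk> \<Longrightarrow> x = \<bottom>"
  by (rule le_antisym[OF _ bottom_lower]) simp_all

lemma meet_join:
  "\<lbrakk>x \<in> carrier M; y \<in> carrier M; z \<in> carrier M\<rbrakk> \<Longrightarrow> x \<sqinter> (y \<squnion> z) = (x \<sqinter> y) \<squnion> (x \<sqinter> z)"
  using alg unfolding mt_algebra_def complete_boolean_def by blast

lemma meet_top: assumes "x \<in> carrier M" shows "x \<sqinter> \<top> = x"
  by (rule le_antisym) (use assms in \<open>simp_all add: meet_left meet_le top_higher\<close>)

lemma join_bottom: assumes "x \<in> carrier M" shows "\<bottom> \<squnion> x = x"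
  by (rule le_antisym) (use assms in \<open>simp_all add: join_right join_le bottom_lower\<close>)

text \<open>By distributivity y equals its meet with z. Both uniqueness of complements and the
  adjunction \<open>le_neg_iff\<close> rest on this.\<close>

lemma complement_le:
  assumes "x \<in> carrier M" "y \<in> carrier M" "z \<in> carrier M"
    and "x \<squnion> z = \<top>" "x \<sqinter> y = \<bottom>"
  shows "y \<sqsubseteq> z"
proof -
  have "y = y \<sqinter> (x \<squnion> z)" using assms meet_top by simp
  also have "\<dots> = \<bottom> \<squnion> (y \<sqinter> z)" using assms meet_join[of y x z] meet_comm[of M y x] by simp
  also have "\<dots> = y \<sqinter> z" using assms by (intro join_bottom) simp
  finally have "y = y \<sqinter> z" .
  then show ?thesis using meet_right[OF assms(2,3)] by argo
qed

lemma neg_unique: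
  assumes "x \<in> carrier M" "y \<in> carrier M" "x \<sqinter> y = \<bottom>" "x \<squnion> y = \<top>"
  shows "neg M x = y"
  unfolding neg_def
proof (rule the_equality)
  show "y \<in> carrier M \<and> x \<sqinter> y = \<bottom> \<and> x \<squnion> y = \<top>" using assms by simp
  fix z assume z: "z \<in> carrier M \<and> x \<sqinter> z = \<bottom> \<and> x \<squnion> z = \<top>"
  show "z = y"
    by (rule le_antisym) (use z assms complement_le[of x z y] complement_le[of x y z] in simp_all)
qed

lemma neg:
  assumes x: "x \<in> carrier M"
  shows neg_closed: "neg M x \<in> carrier M" and meet_neg: "x \<sqinter> neg M x = \<bottom>"
    and join_neg: "x \<squnion> neg M x = \<top>"
proof -
  obtain y where y: "y \<in> carrier M" "x \<sqinter> y = \<bottom>" "x \<squnion> y = \<top>"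
    using alg x unfolding mt_algebra_def complete_boolean_def by blast
  have "neg M x = y" by (rule neg_unique[OF x y])
  with y show "neg M x \<in> carrier M" "x \<sqinter> neg M x = \<bottom>" "x \<squnion> neg M x = \<top>" by simp_all
qed

lemma neg_neg: "x \<in> carrier M \<Longrightarrow> neg M (neg M x) = x"
  using meet_comm[of M x "neg M x"] join_comm[of M x "neg M x"]
  by (intro neg_unique) (simp_all add: neg_closed meet_neg join_neg)

lemma le_neg_iff:
  assumes a: "a \<in> carrier M" and b: "b \<in> carrier M"
  shows "a \<sqsubseteq> neg M b \<longleftrightarrow> b \<sqinter> a = \<bottom>"
proof
  assume le: "a \<sqsubseteq> neg M b"
  note nb = neg_closed[OF b]
  have "b \<sqinter> a \<sqsubseteq> b \<sqinter> neg M b"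
    using a b nb le_trans[OF meet_right[OF b a] le] by (intro meet_le meet_left) simp_all
  then show "b \<sqinter> a = \<bottom>" unfolding meet_neg[OF b] using a b by (intro le_bottom) simp_all
qed (use complement_le[OF b a neg_closed[OF b] join_neg[OF b]] in simp)

lemma neg_le_neg:
  assumes "a \<in> carrier M" "b \<in> carrier M" "a \<sqsubseteq> b"
  shows "neg M b \<sqsubseteq> neg M a"
  using le_neg_iff[of "neg M b" a] le_neg_iff[of a "neg M b"] assms
    meet_comm[of M a "neg M b"] by (simp add: neg_closed neg_neg)

lemma neg_top_iff: assumes a: "a \<in> carrier M" shows "neg M a = \<top> \<longleftrightarrow> a = \<bottom>"
proof
  assume "neg M a = \<top>"
  then show "a = \<bottom>" using meet_neg[OF a] meet_top[OF a] by simp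
next
  assume "a = \<bottom>"
  then show "neg M a = \<top>" using join_neg[OF a] join_bottom[OF neg_closed[OF a]] by simp
qed

lemma Box_closed: "a \<in> carrier M \<Longrightarrow> Box M a \<in> carrier M"
  and Box_meet: "\<lbrakk>a \<in> carrier M; b \<in> carrier M\<rbrakk> \<Longrightarrow> Box M (a \<sqinter> b) = Box M a \<sqinter> Box M b"
  and Box_le: "a \<in> carrier M \<Longrightarrow> Box M a \<sqsubseteq> a"
  and Box_le_Box_Box: "a \<in> carrier M \<Longrightarrow> Box M a \<sqsubseteq> Box M (Box M a)"
  using alg unfolding mt_algebra_def by blast+

lemma Box_mono:
  assumes "a \<in> carrier M" "b \<in> carrier M" "a \<sqsubseteq> b"
  shows "Box M a \<sqsubseteq> Box M b"
proof -
  have "a \<sqinter> b = a"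
    by (rule le_antisym) (use assms in \<open>simp_all add: meet_left meet_le\<close>)
  then have "Box M a = Box M a \<sqinter> Box M b" using Box_meet[OF assms(1,2)] by argo
  then show ?thesis using meet_right[OF Box_closed[OF assms(1)] Box_closed[OF assms(2)]] by argo
qed

lemma mt_opensI: "\<lbrakk>a \<in> carrier M; a \<sqsubseteq> Box M a\<rbrakk> \<Longrightarrow> a \<in> mt_opens M"
  unfolding mt_opens_def using le_antisym[OF _ Box_le] Box_closed by blast

lemma mt_opens_closed: "a \<in> mt_opens M \<Longrightarrow> a \<in> carrier M"
  and mt_opens_le: "a \<in> mt_opens M \<Longrightarrow> a \<sqsubseteq> Box M a"
  unfolding mt_opens_def by (metis (mono_tags, lifting) CollectD le_refl)+

lemma Box_open: "a \<in> carrier M \<Longrightarrow> Box M a \<in> mt_opens M"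
  by (intro mt_opensI Box_closed Box_le_Box_Box)

lemma mt_opens_sup:
  assumes S: "S \<subseteq> mt_opens M"
  shows "\<Squnion>S \<in> mt_opens M"
proof (rule mt_opensI)
  have Sc: "S \<subseteq> carrier M" using S mt_opens_closed by blast
  note c = sup_closed[OF Sc]
  show "\<Squnion>S \<in> carrier M" by (rule c)
  show "\<Squnion>S \<sqsubseteq> Box M (\<Squnion>S)"
  proof (rule sup_least[OF Sc Box_closed[OF c]])
    fix s assume s: "s \<in> S"
    then have sc: "s \<in> carrier M" and so: "s \<in> mt_opens M" using S Sc by auto
    show "s \<sqsubseteq> Box M (\<Squnion>S)"
      by (rule le_trans[OF mt_opens_le[OF so] Box_mono[OF sc c sup_upper[OF Sc s]]])
        (simp_all add: sc c Box_closed)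
  qed
qed

lemma mt_opens_meet:
  assumes "a \<in> mt_opens M" "b \<in> mt_opens M"
  shows "a \<sqinter> b \<in> mt_opens M"
  using assms Box_meet[of a b] by (simp add: mt_opens_def)

lemma mt_closeds_iff: "a \<in> mt_closeds M \<longleftrightarrow> a \<in> carrier M \<and> neg M a \<in> mt_opens M"
proof (cases "a \<in> carrier M")
  case a: True
  note na = neg_closed[OF a]
  have "a = Dia M a \<longleftrightarrow> neg M a = Box M (neg M a)"
    unfolding Dia_def using neg_neg[OF a] neg_neg[OF Box_closed[OF na]] by metis
  then show ?thesis unfolding mt_closeds_def mt_opens_def using a na by blast
qed (simp add: mt_closeds_def)

lemma mt_atoms_closed: "x \<in> mt_atoms M \<Longrightarrow> x \<in> carrier M"
  and mt_atoms_ne: "x \<in> mt_atoms M \<Longrightarrow> x \<noteq> \<bottom>"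
  and mt_atoms_min: "\<lbrakk>x \<in> mt_atoms M; b \<in> carrier M; b \<sqsubseteq> x\<rbrakk> \<Longrightarrow> b = \<bottom> \<or> b = x"
  unfolding mt_atoms_def by blast+

lemma mt_atoms_meet:
  assumes x: "x \<in> mt_atoms M" and s: "s \<in> carrier M" "\<not> x \<sqsubseteq> s"
  shows "x \<sqinter> s = \<bottom>"
proof -
  note xc = mt_atoms_closed[OF x]
  have "x \<sqinter> s = \<bottom> \<or> x \<sqinter> s = x" using xc s by (intro mt_atoms_min[OF x]) (simp_all add: meet_left)
  then show ?thesis using meet_right[OF xc s(1)] s(2) by auto
qed

text \<open>Atoms are completely join-prime: an atom below no member of S meets each of them in
  bottom, so all of them, and hence their supremum, lie below its negation. If the atom were below
  the supremum, it would be below its own negation.\<close>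

lemma mt_atoms_le_sup_iff:
  assumes x: "x \<in> mt_atoms M" and S: "S \<subseteq> carrier M"
  shows "x \<sqsubseteq> \<Squnion>S \<longleftrightarrow> (\<exists>s\<in>S. x \<sqsubseteq> s)"
proof
  note xc = mt_atoms_closed[OF x]
  assume le: "x \<sqsubseteq> \<Squnion>S"
  show "\<exists>s\<in>S. x \<sqsubseteq> s"
  proof (rule ccontr)
    assume n: "\<not> ?thesis"
    have "\<Squnion>S \<sqsubseteq> neg M x"
    proof (rule sup_least[OF S neg_closed[OF xc]])
      fix s assume s: "s \<in> S"
      then have sc: "s \<in> carrier M" using S by blast
      show "s \<sqsubseteq> neg M x" using n s mt_atoms_meet[OF x sc] le_neg_iff[OF sc xc] by blast
    qed
    then have "x \<sqsubseteq> neg M x"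
      using le_trans[OF le _ xc sup_closed[OF S] neg_closed[OF xc]] by blast
    then have "x \<sqinter> x = \<bottom>" using le_neg_iff[OF xc xc] by blast
    moreover have "x \<sqsubseteq> x \<sqinter> x" using xc by (intro meet_le) simp_all
    ultimately show False using le_bottom[of x] xc mt_atoms_ne[OF x] by simp
  qed
next
  note xc = mt_atoms_closed[OF x]
  assume "\<exists>s\<in>S. x \<sqsubseteq> s"
  then obtain s where s: "s \<in> S" "x \<sqsubseteq> s" by blast
  show "x \<sqsubseteq> \<Squnion>S"
    by (rule le_trans[OF s(2) sup_upper[OF S s(1)]]) (use xc s S sup_closed[OF S] in auto)
qed

end

section \<open>The space of atoms of a Stone MT-algebra\<close>

locale stone_mt_alg = mt_alg M for M :: "'b mt" (structure) +
  assumes stone: "stone_mt M"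
begin

lemma ex_closed_below:
  assumes a: "a \<in> carrier M" "a \<noteq> \<bottom>"
  shows "\<exists>c\<in>mt_closeds M. c \<noteq> \<bottom> \<and> c \<sqsubseteq> a"
proof (rule ccontr)
  assume n: "\<not> ?thesis"
  obtain S where S: "S \<subseteq> mt_closeds M" "a = \<Squnion>S"
    using stone a(1) unfolding stone_mt_def mt_zero_dimensional_def mt_T1_def by blast
  have Sc: "S \<subseteq> carrier M" using S mt_closeds_iff by blast
  have "\<Squnion>S \<sqsubseteq> \<bottom>"
  proof (rule sup_least[OF Sc bottom_closed])
    fix s assume s: "s \<in> S"
    then have "s = \<bottom>" using n S sup_upper[OF Sc s] by blast
    then show "s \<sqsubseteq> \<bottom>" by simp
  qed
  then show False using le_bottom[OF _ sup_closed[OF Sc]] a(2) S(2) by simp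
qed

text \<open>Passing first to a nonbottom closed c below a makes \<open>neg M c\<close> open; a
  maximal proper open element above it has its negation below c, hence below a.\<close>

lemma ex_atom_below:
  assumes a: "a \<in> carrier M" "a \<noteq> \<bottom>"
  shows "\<exists>x\<in>mt_atoms M. x \<sqsubseteq> a"
proof -
  obtain c where c: "c \<in> mt_closeds M" "c \<noteq> \<bottom>" "c \<sqsubseteq> a" using ex_closed_below[OF a] by blast
  have cc: "c \<in> carrier M" and co: "neg M c \<in> mt_opens M" using c mt_closeds_iff by auto
  have "\<exists>m\<in>mt_opens M. neg M c \<sqsubseteq> m \<and> m \<noteq> \<top> \<and>
      (\<forall>b\<in>mt_opens M. m \<sqsubseteq> b \<longrightarrow> b = \<top> \<or> b = m)"
  proof (rule ex_maximal_below_top)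
    show "mt_opens M \<subseteq> carrier M" using mt_opens_closed by blast
    show "\<exists>T\<subseteq>S. finite T \<and> \<Squnion>T = \<top>" if "S \<subseteq> mt_opens M" "\<Squnion>S = \<top>" for S
      using stone that unfolding stone_mt_def mt_compact_def by blast
    show "neg M c \<noteq> \<top>" using c(2) neg_top_iff[OF cc] by simp
  qed (simp_all add: mt_opens_sup co)
  then obtain m where m: "m \<in> mt_opens M" "neg M c \<sqsubseteq> m" "m \<noteq> \<top>"
    and max: "\<And>b. \<lbrakk>b \<in> mt_opens M; m \<sqsubseteq> b\<rbrakk> \<Longrightarrow> b = \<top> \<or> b = m" by blast
  note mc = mt_opens_closed[OF m(1)]
  note nm = neg_closed[OF mc]
  have "neg M m \<sqsubseteq> c" using neg_le_neg[OF neg_closed[OF cc] mc m(2)] neg_neg[OF cc] by simp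
  then have nma: "neg M m \<sqsubseteq> a" using le_trans[OF _ c(3) nm cc a(1)] by blast
  have "neg M m \<in> mt_atoms M"
    unfolding mt_atoms_def
  proof (intro CollectI conjI ballI impI)
    show "neg M m \<in> carrier M" by (rule nm)
    show "neg M m \<noteq> \<bottom>" using neg_top_iff[OF nm] neg_neg[OF mc] m(3) by auto
    fix b assume b: "b \<in> carrier M" "b \<sqsubseteq> neg M m"
    show "b = \<bottom> \<or> b = neg M m"
    proof (rule disjCI)
      assume ne: "b \<noteq> neg M m"
      show "b = \<bottom>"
      proof (rule ccontr)
        assume "b \<noteq> \<bottom>"
        \<comment> \<open>b need not be closed, so maximality of m is applied to a closed d inside
          it: d turns out to be \<open>neg M m\<close>, and b is squeezed between the two.\<close>
        then obtain d where d: "d \<in> mt_closeds M" "d \<noteq> \<bottom>" "d \<sqsubseteq> b"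
          using ex_closed_below[OF b(1)] by blast
        have dc: "d \<in> carrier M" and do: "neg M d \<in> mt_opens M" using d mt_closeds_iff by auto
        have "m \<sqsubseteq> neg M d"
          using neg_le_neg[OF dc nm le_trans[OF d(3) b(2) dc b(1) nm]] neg_neg[OF mc] by simp
        then have "neg M d = m" using max[OF do] neg_top_iff[OF dc] d(2) by blast
        then have "neg M m = d" using neg_neg[OF dc] by simp
        then have "b = neg M m" using le_antisym[OF b(2) _ b(1) nm] d(3) by simp
        with ne show False by simp
      qed
    qed
  qed
  then show ?thesis using nma by blast
qed

lemma atoms_separate:
  assumes a: "a \<in> carrier M" and b: "b \<in> carrier M" and n: "\<not> a \<sqsubseteq> b"
  shows "\<exists>x\<in>mt_atoms M. x \<sqsubseteq> a \<and> \<not> x \<sqsubseteq> b"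
proof -
  note nb = neg_closed[OF b]
  have "neg M b \<sqinter> a \<noteq> \<bottom>" using n le_neg_iff[OF a nb] neg_neg[OF b] by simp
  then obtain x where x: "x \<in> mt_atoms M" "x \<sqsubseteq> neg M b \<sqinter> a"
    using ex_atom_below[OF meet_closed[OF nb a]] by blast
  note xc = mt_atoms_closed[OF x(1)]
  have xn: "x \<sqsubseteq> neg M b" and xa: "x \<sqsubseteq> a"
    using le_trans[OF x(2) meet_left[OF nb a] xc meet_closed[OF nb a] nb]
      le_trans[OF x(2) meet_right[OF nb a] xc meet_closed[OF nb a] a] by blast+
  have "\<not> x \<sqsubseteq> b"
  proof
    assume "x \<sqsubseteq> b"
    then have "x \<sqsubseteq> b \<sqinter> x" using xc b by (intro meet_le) simp_all
    then have "x \<sqsubseteq> \<bottom>" using le_neg_iff[OF xc b] xn by simp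
    then show False using le_bottom[OF _ xc] mt_atoms_ne[OF x(1)] by blast
  qed
  with xa x(1) show ?thesis by blast
qed

text \<open>An element goes to the set of atoms below it. Join-primality turns joins into unions,
  and suprema of sets of atoms show that every set of atoms occurs. Only the images of open elements
  are declared open; as \<open>Box M a\<close> is the largest open element below a, it represents
  the interior.\<close>

lemma ex_space:
  fixes i :: "'b \<Rightarrow> 'a"
  assumes i: "inj_on i (mt_atoms M)"
  shows "\<exists>X r. topspace X = i ` mt_atoms M \<and> stone_space X \<and> mt_rep M X r"
proof -
  define r where "r a = i ` {x \<in> mt_atoms M. x \<sqsubseteq> a}" for a
  have mem: "i x \<in> r a \<longleftrightarrow> x \<sqsubseteq> a" if "x \<in> mt_atoms M" for x a
    using that i by (auto simp: r_def inj_on_def)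
  have le: "a \<sqsubseteq> b \<longleftrightarrow> r a \<subseteq> r b" if ab: "a \<in> carrier M" "b \<in> carrier M" for a b
  proof
    assume le: "a \<sqsubseteq> b"
    show "r a \<subseteq> r b"
      unfolding r_def
    proof (rule image_mono, rule subsetI)
      fix p assume "p \<in> {p \<in> mt_atoms M. p \<sqsubseteq> a}"
      then show "p \<in> {p \<in> mt_atoms M. p \<sqsubseteq> b}"
        using le_trans[OF _ le _ ab, of p] mt_atoms_closed[of p] by blast
    qed
  next
    assume s: "r a \<subseteq> r b"
    show "a \<sqsubseteq> b"
    proof (rule ccontr)
      assume "\<not> a \<sqsubseteq> b"
      then obtain x where x: "x \<in> mt_atoms M" "x \<sqsubseteq> a" "\<not> x \<sqsubseteq> b"
        using atoms_separate[OF ab] by blast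
      then show False using subsetD[OF s, of "i x"] unfolding mem[OF x(1)] by blast
    qed
  qed
  have rsup: "r (\<Squnion>S) = \<Union>(r ` S)" if S: "S \<subseteq> carrier M" for S
  proof -
    have "{x \<in> mt_atoms M. x \<sqsubseteq> \<Squnion>S} = (\<Union>s\<in>S. {x \<in> mt_atoms M. x \<sqsubseteq> s})"
      by (intro Set.set_eqI) (auto simp: mt_atoms_le_sup_iff[OF _ S] cong: conj_cong)
    then have "r (\<Squnion>S) = i ` (\<Union>s\<in>S. {x \<in> mt_atoms M. x \<sqsubseteq> s})" by (simp only: r_def)
    also have "\<dots> = (\<Union>s\<in>S. i ` {x \<in> mt_atoms M. x \<sqsubseteq> s})" by (rule image_UN)
    also have "\<dots> = \<Union>(r ` S)" by (rule SUP_cong[OF HOL.refl]) (simp only: r_def)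
    finally show ?thesis .
  qed
  have eq: "a = b" if "a \<in> carrier M" "b \<in> carrier M" "r a = r b" for a b
    using le_antisym[of a b] le[of a b] le[of b a] that by simp
  have ratom: "r x = {i x}" if x: "x \<in> mt_atoms M" for x
  proof -
    have "y = x" if "y \<in> mt_atoms M" "y \<sqsubseteq> x" for y
      using mt_atoms_min[OF x mt_atoms_closed[OF that(1)] that(2)] mt_atoms_ne[OF that(1)] by blast
    then have "{y \<in> mt_atoms M. y \<sqsubseteq> x} = {x}" using x mt_atoms_closed[OF x] by auto
    then show ?thesis by (simp add: r_def)
  qed
  have surj: "\<exists>a\<in>carrier M. r a = V" if "V \<subseteq> i ` mt_atoms M" for V
  proof -
    from that obtain A where A: "A \<subseteq> mt_atoms M" "V = i ` A" by (rule subset_imageE)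
    have Ac: "A \<subseteq> carrier M" using A(1) mt_atoms_closed by blast
    have "\<Union>(r ` A) = (\<Union>x\<in>A. {i x})" by (rule SUP_cong[OF HOL.refl]) (use A(1) ratom in blast)
    then have "r (\<Squnion>A) = V" unfolding rsup[OF Ac] A(2) by blast
    then show ?thesis using sup_closed[OF Ac] by blast
  qed
  have bij: "bij_betw r (carrier M) (Pow (i ` mt_atoms M))"
    unfolding bij_betw_def
  proof (intro conjI inj_onI eq)
    show "r ` carrier M = Pow (i ` mt_atoms M)"
    proof
      show "r ` carrier M \<subseteq> Pow (i ` mt_atoms M)" by (auto simp: r_def)
      show "Pow (i ` mt_atoms M) \<subseteq> r ` carrier M" using surj by blast
    qed
  qed
  \<comment> \<open>The discrete topology stands for the powerset of the atoms before X is
    available; the representation is restated over \<open>topspace X\<close> once that set is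
    identified.\<close>
  have rep: "frm_rep M (discrete_topology (i ` mt_atoms M)) r"
    by unfold_locales (use bij le in \<open>simp_all add: Pow_def\<close>)
  have "istopology (\<lambda>U. U \<in> r ` mt_opens M)"
    unfolding istopology_def
  proof (intro conjI allI impI)
    fix U V assume "U \<in> r ` mt_opens M" "V \<in> r ` mt_opens M"
    then obtain a b where ab: "a \<in> mt_opens M" "b \<in> mt_opens M" "U = r a" "V = r b" by blast
    show "U \<inter> V \<in> r ` mt_opens M"
      unfolding ab(3,4) frm_rep.rep_meet[OF rep mt_opens_closed[OF ab(1)] mt_opens_closed[OF ab(2)], symmetric]
      by (intro imageI mt_opens_meet ab)
  next
    fix \<U> assume "\<forall>U\<in>\<U>. U \<in> r ` mt_opens M"
    then have "\<U> \<subseteq> r ` mt_opens M" by blast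
    then obtain S where S: "S \<subseteq> mt_opens M" "\<U> = r ` S" unfolding subset_image_iff by blast
    have "S \<subseteq> carrier M" using S(1) mt_opens_closed by blast
    from rsup[OF this] show "\<Union>\<U> \<in> r ` mt_opens M"
      unfolding S(2) using imageI[OF mt_opens_sup[OF S(1)], of r] by simp
  qed
  from fun_cong[OF topology_inverse'[OF this]]
  obtain X where X: "\<And>U. openin X U \<longleftrightarrow> U \<in> r ` mt_opens M" by (rule that)
  have top: "topspace X = i ` mt_atoms M"
  proof -
    have "\<Union>{U. openin X U} = i ` mt_atoms M"
    proof
      show "\<Union>{U. openin X U} \<subseteq> i ` mt_atoms M" unfolding X by (auto simp: r_def)
      have "\<top> \<in> mt_opens M" using alg by (simp add: mt_opens_def mt_algebra_def)
      moreover have "r \<top> = i ` mt_atoms M" using frm_rep.rep_top[OF rep] by simp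
      ultimately show "i ` mt_atoms M \<subseteq> \<Union>{U. openin X U}" unfolding X by blast
    qed
    then show ?thesis unfolding topspace_def .
  qed
  interpret R: frm_rep M "discrete_topology (topspace X)" r unfolding top by (rule rep)
  interpret mt_rep M X r
  proof unfold_locales
    fix a assume a: "a \<in> carrier M"
    note ba = Box_closed[OF a]
    show "Box M a \<in> carrier M" by (rule ba)
    show "r (Box M a) = X interior_of r a"
    proof (rule interior_of_unique[symmetric])
      show "r (Box M a) \<subseteq> r a" using Box_le[OF a] le[OF ba a] by blast
      show "openin X (r (Box M a))" unfolding X by (intro imageI Box_open a)
      fix T assume T: "T \<subseteq> r a" "openin X T"
      then obtain u where u: "u \<in> mt_opens M" "T = r u" unfolding X by blast
      note uc = mt_opens_closed[OF u(1)]
      have "u \<sqsubseteq> a" using T(1) le[OF uc a] u(2) by blast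
      then have "u \<sqsubseteq> Box M a"
        using le_trans[OF mt_opens_le[OF u(1)] Box_mono[OF uc a] uc Box_closed[OF uc] ba] by blast
      then show "T \<subseteq> r (Box M a)" using le[OF uc ba] u(2) by blast
    qed
  qed
  have "stone_space X" using stone stone_mt_iff by blast
  then show ?thesis using top mt_rep_axioms by blast
qed

end

section \<open>The equivalences\<close>

text \<open>For extensional maps the unit and associativity laws are automatic, which leaves only
  closure of the hom-sets to the concrete cases.\<close>

lemma is_category_concrete:
  assumes PiE: "\<And>a b f. f \<in> Hom C a b \<Longrightarrow> f \<in> S a \<rightarrow>\<^sub>E S b"
    and Idn: "\<And>a. Idn C a = restrict id (S a)"
    and Cmp: "\<And>a b c f g. Cmp C a b c g f = compose (S a) g f"
    and id: "\<And>a. a \<in> Obj C \<Longrightarrow> restrict id (S a) \<in> Hom C a a"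
    and comp: "\<And>a b c f g. \<lbrakk>a \<in> Obj C; b \<in> Obj C; c \<in> Obj C; f \<in> Hom C a b; g \<in> Hom C b c\<rbrakk>
      \<Longrightarrow> compose (S a) g f \<in> Hom C a c"
  shows "is_category C"
  unfolding is_category_def Idn Cmp
proof (intro conjI ballI)
  fix a b f assume "f \<in> Hom C a b"
  note f = PiE[OF this]
  show "compose (S a) f (restrict id (S a)) = f" "compose (S a) (restrict id (S b)) f = f"
    by (rule ext; rename_tac x; case_tac "x \<in> S a";
        simp add: compose_def PiE_arb[OF f] PiE_mem[OF f])+
next
  fix a b c d f g h assume "f \<in> Hom C a b"
  then have "f \<in> S a \<rightarrow> S b" using PiE by blast
  then show "compose (S a) h (compose (S a) g f) = compose (S a) (compose (S b) h g) f"
    by (intro ext) (simp add: compose_def Pi_iff)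
qed (simp_all only: id comp)

lemma is_category_op_cat: "is_category C \<Longrightarrow> is_category (op_cat C)"
  unfolding is_category_def op_cat_def cat.simps by (intro conjI ballI) (elim conjE; simp)+

text \<open>With the set of objects as a parameter, the version for a universe and the version for a
  single type become instances of one argument.\<close>

definition top_cat :: "'a topology set \<Rightarrow> ('a topology, 'a \<Rightarrow> 'a) cat" where
  "top_cat V = \<lparr>Obj = V, Hom = top_hom, Idn = (\<lambda>X. restrict id (topspace X)),
    Cmp = (\<lambda>X Y Z g f. compose (topspace X) g f)\<rparr>"

lemma top_hom_id: "restrict id (topspace X) \<in> top_hom X X"
  by (auto simp: top_hom_def intro: continuous_map_eq[OF continuous_map_id])

lemma top_hom_compose:
  assumes "f \<in> top_hom X Y" "g \<in> top_hom Y Z"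
  shows "compose (topspace X) g f \<in> top_hom X Z"
proof -
  have "continuous_map X Z (g \<circ> f)"
    using assms by (auto simp: top_hom_def intro: continuous_map_compose)
  then have "continuous_map X Z (compose (topspace X) g f)"
    by (rule continuous_map_eq) (simp add: compose_eq)
  then show ?thesis by (simp add: top_hom_def)
qed

lemma is_category_top_cat: "is_category (top_cat V)"
  by (rule is_category_concrete[where S = topspace])
    (use top_hom_PiE in \<open>auto simp: top_cat_def top_hom_id top_hom_compose\<close>)

text \<open>\<open>Rep\<close> stands for \<open>mt_rep\<close> or \<open>frame_rep\<close>.
  Assumption \<open>t0\<close> separates two roles of the space: morphisms refer to X, while
  uniqueness needs some T0 space T on the same points whose open sets are the values of r. For
  frames T is X itself, for MT-algebras it is the discrete topology.\<close>

lemma equivalence_span_rep: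
  fixes C :: "(('b, 'e) gorder_scheme, 'b \<Rightarrow> 'b) cat" and V :: "'a topology set"
  assumes PiE: "\<And>L K f. f \<in> Hom C L K \<Longrightarrow> f \<in> carrier L \<rightarrow>\<^sub>E carrier K"
    and Idn: "\<And>L. Idn C L = restrict id (carrier L)"
    and Cmp: "\<And>L K J f g. Cmp C L K J g f = compose (carrier L) g f"
    and t0: "\<And>L X r. \<lbrakk>Rep L X r; X \<in> V\<rbrakk>
      \<Longrightarrow> \<exists>T. topspace T = topspace X \<and> t0_space T \<and> frm_rep L T r"
    and ex_map: "\<And>L X r K Y s f. \<lbrakk>Rep L X r; Rep K Y s; X \<in> V; Y \<in> V; f \<in> Hom C L K\<rbrakk>
      \<Longrightarrow> \<exists>\<phi>\<in>top_hom Y X. hom_rel L r Y s f \<phi>"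
    and ex_hom: "\<And>L X r K Y s \<phi>. \<lbrakk>Rep L X r; Rep K Y s; \<phi> \<in> top_hom Y X\<rbrakk>
      \<Longrightarrow> \<exists>f\<in>Hom C L K. hom_rel L r Y s f \<phi>"
    and ex_space: "\<And>L. L \<in> Obj C \<Longrightarrow> \<exists>X\<in>V. \<exists>r. Rep L X r"
    and ex_lattice: "\<And>X. X \<in> V \<Longrightarrow> \<exists>L\<in>Obj C. \<exists>r. Rep L X r"
  shows "equivalence_span C (op_cat (top_cat V)) {(L, X, r). L \<in> Obj C \<and> X \<in> V \<and> Rep L X r}
    (\<lambda>(L, X, r). L) (\<lambda>(L, X, r). X) (\<lambda>(L, X, r) (K, Y, s) f \<phi>. hom_rel L r Y s f \<phi>)"
proof -
  have rep_subset: "r a \<subseteq> topspace X" if "Rep L X r" "X \<in> V" "a \<in> carrier L" for L X r a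
    using t0[OF that(1,2)] frm_rep.rep_subset[OF _ that(3)] by metis
  have left_unique: "f = g"
    if "Rep K Y s" "Y \<in> V" "f \<in> carrier L \<rightarrow>\<^sub>E carrier K" "g \<in> carrier L \<rightarrow>\<^sub>E carrier K"
      "hom_rel L r Y s f \<phi>" "hom_rel L r Y s g \<phi>" for L r K Y s f g \<phi>
    using t0[OF that(1,2)] hom_rel_left_unique[OF _ that(3-6)] by blast
  have right_unique: "\<phi> = \<psi>"
    if X: "Rep L X r" "X \<in> V" and "\<phi> \<in> top_hom Y X" "\<psi> \<in> top_hom Y X"
      "hom_rel L r Y s f \<phi>" "hom_rel L r Y s f \<psi>" for L X r Y s f \<phi> \<psi>
  proof -
    obtain T where T: "topspace T = topspace X" "t0_space T" "frm_rep L T r"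
      using t0[OF X] by blast
    show ?thesis
      by (rule hom_rel_right_unique[OF T(3,2) _ _ that(5,6)])
        (use subsetD[OF top_hom_PiE that(3)] subsetD[OF top_hom_PiE that(4)] T(1) in simp_all)
  qed
  have id_rel: "hom_rel L r X r (restrict id (carrier L)) (restrict id (topspace X))"
    if "Rep L X r" "X \<in> V" for L X r
    by (rule hom_rel_id) (rule rep_subset[OF that])
  have comp_rel: "hom_rel L r Z t (compose (carrier L) g f) (compose (topspace Z) \<phi> \<psi>)"
    if "f \<in> Hom C L K" "\<psi> \<in> top_hom Z Y" "hom_rel L r Y s f \<phi>" "hom_rel K s Z t g \<psi>"
    for L r K Y s Z t f g \<phi> \<psi>
    by (rule hom_rel_compose[OF _ _ that(3,4)])
      (use PiE[OF that(1)] subsetD[OF top_hom_PiE that(2)] in blast)+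
  have C: "is_category C"
  proof (rule is_category_concrete[where S = carrier])
    \<comment> \<open>Closure under identities and composites is inherited from the continuous maps.\<close>
    fix L assume "L \<in> Obj C"
    then obtain X r where X: "X \<in> V" "Rep L X r" using ex_space by blast
    then obtain f where f: "f \<in> Hom C L L" "hom_rel L r X r f (restrict id (topspace X))"
      using ex_hom[OF _ _ top_hom_id] by blast
    have "f = restrict id (carrier L)"
      by (rule left_unique[OF X(2,1) PiE[OF f(1)] _ f(2) id_rel[OF X(2,1)]]) auto
    then show "restrict id (carrier L) \<in> Hom C L L" using f(1) by simp
  next
    fix L K J f g
    assume "L \<in> Obj C" "K \<in> Obj C" "J \<in> Obj C" and fg: "f \<in> Hom C L K" "g \<in> Hom C K J"
    then obtain X r Y s Z t where X: "X \<in> V" "Rep L X r" and Y: "Y \<in> V" "Rep K Y s"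
      and Z: "Z \<in> V" "Rep J Z t" using ex_space by meson
    obtain \<phi> where p: "\<phi> \<in> top_hom Y X" "hom_rel L r Y s f \<phi>"
      using ex_map[OF X(2) Y(2) X(1) Y(1) fg(1)] by blast
    obtain \<psi> where q: "\<psi> \<in> top_hom Z Y" "hom_rel K s Z t g \<psi>"
      using ex_map[OF Y(2) Z(2) Y(1) Z(1) fg(2)] by blast
    obtain h where h: "h \<in> Hom C L J" "hom_rel L r Z t h (compose (topspace Z) \<phi> \<psi>)"
      using ex_hom[OF X(2) Z(2) top_hom_compose[OF q(1) p(1)]] by blast
    have "compose (carrier L) g f \<in> carrier L \<rightarrow>\<^sub>E carrier J"
      using PiE[OF fg(1)] PiE[OF fg(2)] by (auto simp: compose_def PiE_def Pi_def)
    from left_unique[OF Z(2,1) PiE[OF h(1)] this h(2) comp_rel[OF fg(1) q(1) p(2) q(2)]]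
    show "compose (carrier L) g f \<in> Hom C L J" using h(1) by simp
  qed (use PiE Idn Cmp in auto)
  show ?thesis
  proof (unfold_locales, goal_cases)
    case 1 show ?case by (rule C)
  next
    case 2 show ?case by (rule is_category_op_cat[OF is_category_top_cat])
  next
    case 3 show ?case using ex_space by force
  next
    case 4 show ?case using ex_lattice by (force simp: op_cat_def top_cat_def)
  next
    case (5 i j f) then show ?case
      using ex_map by (force simp: op_cat_def top_cat_def)
  next
    case (6 i j g) then show ?case
      using ex_hom by (force simp: op_cat_def top_cat_def)
  next
    case (7 i j f g g') then show ?case
      by (auto simp: op_cat_def top_cat_def intro: right_unique)
  next
    case (8 i j f f' g)
    then obtain L X r K Y s where "i = (L, X, r)" "j = (K, Y, s)" "Rep K Y s" "Y \<in> V"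
      "f \<in> Hom C L K" "f' \<in> Hom C L K" "hom_rel L r Y s f g" "hom_rel L r Y s f' g" by auto
    then show ?case using left_unique[OF _ _ PiE PiE] by blast
  next
    case (9 i) then show ?case
      by (auto simp: op_cat_def top_cat_def Idn id_rel)
  next
    case (10 i j k f f' g g') then show ?case
      by (auto simp: op_cat_def top_cat_def Cmp intro: comp_rel)
  qed
qed

definition mt_cat :: "'b mt set \<Rightarrow> ('b mt, 'b \<Rightarrow> 'b) cat" where
  "mt_cat A = \<lparr>Obj = A, Hom = mt_hom, Idn = (\<lambda>M. restrict id (carrier M)),
    Cmp = (\<lambda>M N K g f. compose (carrier M) g f)\<rparr>"

definition frm_cat :: "'b gorder set \<Rightarrow> ('b gorder, 'b \<Rightarrow> 'b) cat" where
  "frm_cat A = \<lparr>Obj = A, Hom = frm_hom, Idn = (\<lambda>L. restrict id (carrier L)),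
    Cmp = (\<lambda>L K J g f. compose (carrier L) g f)\<rparr>"

lemma mt_cat_simps [simp]:
  "Obj (mt_cat A) = A" "Hom (mt_cat A) = mt_hom" "Idn (mt_cat A) M = restrict id (carrier M)"
  "Cmp (mt_cat A) M N K g f = compose (carrier M) g f"
  by (simp_all add: mt_cat_def)

lemma frm_cat_simps [simp]:
  "Obj (frm_cat A) = A" "Hom (frm_cat A) = frm_hom" "Idn (frm_cat A) L = restrict id (carrier L)"
  "Cmp (frm_cat A) L K J g f = compose (carrier L) g f"
  by (simp_all add: frm_cat_def)

lemma equivalence_span_mt:
  fixes A :: "'b mt set" and V :: "'a topology set"
  assumes "\<And>M. M \<in> A \<Longrightarrow> \<exists>X\<in>V. \<exists>r. mt_rep M X r"
    and "\<And>X. X \<in> V \<Longrightarrow> \<exists>M\<in>A. \<exists>r. mt_rep M X r"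
  shows "equivalence_span (mt_cat A) (op_cat (top_cat V))
    {(M, X, r). M \<in> Obj (mt_cat A) \<and> X \<in> V \<and> mt_rep M X r}
    (\<lambda>(M, X, r). M) (\<lambda>(M, X, r). X) (\<lambda>(M, X, r) (N, Y, s) f \<phi>. hom_rel M r Y s f \<phi>)"
proof (rule equivalence_span_rep)
  show "\<exists>T. topspace T = topspace X \<and> t0_space T \<and> frm_rep M T r" if "mt_rep M X r"
    for M :: "'b mt" and X :: "'a topology" and r
    using mt_rep.axioms(1)[OF that]
    by (intro exI[of _ "discrete_topology (topspace X)"])
      (simp add: Hausdorff_imp_t1_space t1_imp_t0_space)
  show "\<exists>\<phi>\<in>top_hom Y X. hom_rel M r Y s f \<phi>"
    if "mt_rep M X r" "mt_rep N Y s" "f \<in> Hom (mt_cat A) M N"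
    for M N :: "'b mt" and X Y :: "'a topology" and r s f
    using ex_dual_map_mt[OF that(1,2)] that(3) by simp
  show "\<exists>f\<in>Hom (mt_cat A) M N. hom_rel M r Y s f \<phi>"
    if "mt_rep M X r" "mt_rep N Y s" "\<phi> \<in> top_hom Y X"
    for M N :: "'b mt" and X Y :: "'a topology" and r s \<phi>
    using ex_dual_mt_hom[OF that] by simp
  show "f \<in> carrier M \<rightarrow>\<^sub>E carrier N" if "f \<in> Hom (mt_cat A) M N" for M N f
    using that by (simp add: mt_hom_def)
qed (use assms in simp_all)

lemma equivalence_span_frm:
  fixes A :: "'b gorder set" and V :: "'a topology set"
  assumes V: "V \<subseteq> Collect stone_space"
    and "\<And>L. L \<in> A \<Longrightarrow> \<exists>X\<in>V. \<exists>r. frame_rep L X r"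
    and "\<And>X. X \<in> V \<Longrightarrow> \<exists>L\<in>A. \<exists>r. frame_rep L X r"
  shows "equivalence_span (frm_cat A) (op_cat (top_cat V))
    {(L, X, r). L \<in> Obj (frm_cat A) \<and> X \<in> V \<and> frame_rep L X r}
    (\<lambda>(L, X, r). L) (\<lambda>(L, X, r). X) (\<lambda>(L, X, r) (K, Y, s) f \<phi>. hom_rel L r Y s f \<phi>)"
proof (rule equivalence_span_rep)
  show "\<exists>T. topspace T = topspace X \<and> t0_space T \<and> frm_rep L T r"
    if "frame_rep L X r" "X \<in> V" for L :: "'b gorder" and X :: "'a topology" and r
    using that(1) stone_space_t0[of X] subsetD[OF V that(2)]
    by (intro exI[of _ X]) (simp add: frame_rep_def)
  show "\<exists>\<phi>\<in>top_hom Y X. hom_rel L r Y s f \<phi>"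
    if "frame_rep L X r" "frame_rep K Y s" "X \<in> V" "f \<in> Hom (frm_cat A) L K"
    for L K :: "'b gorder" and X Y :: "'a topology" and r s f
  proof (rule ex_dual_map)
    show "frm_rep L X r" "frm_rep K Y s" using that by (simp_all add: frame_rep_def)
    show "Hausdorff_space X" using subsetD[OF V that(3)] by (intro stone_space_Hausdorff) simp
  qed (use that(4) in \<open>auto simp: frm_hom_def\<close>)
  show "\<exists>f\<in>Hom (frm_cat A) L K. hom_rel L r Y s f \<phi>"
    if "frame_rep L X r" "frame_rep K Y s" "\<phi> \<in> top_hom Y X"
    for L K :: "'b gorder" and X Y :: "'a topology" and r s \<phi>
    using ex_dual_frm_hom[OF that] by simp
  show "f \<in> carrier L \<rightarrow>\<^sub>E carrier K" if "f \<in> Hom (frm_cat A) L K" for L K f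
    using that by (simp add: frm_hom_def)
qed (use assms in simp_all)

text \<open>Both spans end in the opposite of the same category of spaces, so reversing the one for
  frames and composing leads from MT-algebras to frames covariantly.\<close>

lemma equivalent_mt_frm_top:
  assumes V: "V \<subseteq> Collect stone_space"
    and "\<And>M. M \<in> A \<Longrightarrow> \<exists>X\<in>V. \<exists>r. mt_rep M X r"
    and "\<And>X. X \<in> V \<Longrightarrow> \<exists>M\<in>A. \<exists>r. mt_rep M X r"
    and "\<And>L. L \<in> B \<Longrightarrow> \<exists>X\<in>V. \<exists>r. frame_rep L X r"
    and "\<And>X. X \<in> V \<Longrightarrow> \<exists>L\<in>B. \<exists>r. frame_rep L X r"
  shows "equivalent (mt_cat A) (frm_cat B)" "dually_equivalent (mt_cat A) (top_cat V)"
proof -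
  note m = equivalence_span_mt[OF assms(2,3)] and f = equivalence_span_frm[OF assms(1,4,5)]
  show "equivalent (mt_cat A) (frm_cat B)"
    by (rule equivalence_span.equivalent[OF equivalence_span_compose[OF m
          equivalence_span.equivalence_span_converse[OF f]]])
  show "dually_equivalent (mt_cat A) (top_cat V)"
    unfolding dually_equivalent_def by (rule equivalence_span.equivalent[OF m])
qed

section \<open>Instances for a universe and for a single type\<close>

lemma stone_mt_algI: "stone_mt M \<Longrightarrow> stone_mt_alg M"
  by (auto simp: stone_mt_def mt_algebra_def complete_boolean_def stone_mt_alg_def mt_alg_def
      mt_alg_axioms_def stone_mt_alg_axioms_def)

lemma stone_frmI: "stone_frame L \<Longrightarrow> stone_frm L"
  by (auto simp: stone_frame_def is_frame_def stone_frm_def stone_frm_axioms_def)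

theorem theorem7p13:
  shows "(\<forall>U :: 'u set set. universe U \<longrightarrow>
            equivalent (StoneMT U) (StoneFrm U) \<and> dually_equivalent (StoneMT U) (Stone U)) \<and>
         equivalent (StoneMT_upto TYPE('p)) (StoneFrm_upto TYPE('p)) \<and>
         dually_equivalent (StoneMT_upto TYPE('p)) (Stone (UNIV :: 'p set set))"
proof (intro conjI allI impI)
  fix U :: "'u set set" assume U: "universe U"
  have sub: "B \<in> U" if "A \<in> U" "B \<lesssim> A" for A B
    using U[unfolded universe_def, THEN conjunct1, rule_format, OF that] .
  \<comment> \<open>The universe only provides a member into which the powerset embeds; closure
    under smaller cardinality brings the image of the embedding into U as well.\<close>
  have pow: "\<exists>e. inj_on e (Pow A) \<and> e ` Pow A \<in> U" if A: "A \<in> U" for A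
  proof -
    obtain B where B: "B \<in> U" "Pow A \<lesssim> B"
      using U[unfolded universe_def, THEN conjunct2, rule_format, OF A] by (elim bexE)
    then obtain e where e: "inj_on e (Pow A)" "e ` Pow A \<subseteq> B" unfolding lepoll_def by (elim exE conjE)
    show ?thesis using e(1) sub[OF B(1) subset_imp_lepoll[OF e(2)]] by (intro exI conjI)
  qed
  let ?A = "{M :: 'u mt. carrier M \<in> U \<and> stone_mt M}"
  let ?B = "{L :: 'u gorder. carrier L \<in> U \<and> stone_frame L}"
  let ?V = "{X :: 'u topology. topspace X \<in> U \<and> stone_space X}"
  have 1: "\<exists>X\<in>?V. \<exists>r. mt_rep M X r" if M: "M \<in> ?A" for M
  proof -
    interpret stone_mt_alg M using M by (intro stone_mt_algI) simp
    obtain X and r :: "'u \<Rightarrow> 'u set" where X: "topspace X = id ` mt_atoms M" "stone_space X" "mt_rep M X r"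
      using ex_space[OF inj_on_id] by blast
    have "mt_atoms M \<subseteq> carrier M" using mt_atoms_closed by blast
    then have "topspace X \<in> U" using M X(1) sub[of "carrier M", OF _ subset_imp_lepoll] by simp
    then show ?thesis using X by blast
  qed
  have 2: "\<exists>M\<in>?A. \<exists>r. mt_rep M X r" if X: "X \<in> ?V" for X
  proof -
    obtain e where e: "inj_on e (Pow (topspace X))" "e ` Pow (topspace X) \<in> U"
      using pow X by blast
    obtain M :: "'u mt" and r
      where M: "carrier M = e ` Pow (topspace X)" "stone_mt M" "mt_rep M X r"
      using ex_mt_of_space[OF _ e(1)] X by blast
    then have "M \<in> ?A" using e(2) by simp
    with M(3) show ?thesis by blast
  qed
  have 3: "\<exists>X\<in>?V. \<exists>r. frame_rep L X r" if L: "L \<in> ?B" for L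
  proof -
    interpret stone_frm L using L by (intro stone_frmI) simp
    obtain X and r :: "'u \<Rightarrow> 'u set" where X: "topspace X = id ` frm_coatoms L" "stone_space X" "frame_rep L X r"
      using ex_space[OF inj_on_id] by blast
    have "frm_coatoms L \<subseteq> carrier L" using frm_coatoms_closed by blast
    then have "topspace X \<in> U" using L X(1) sub[of "carrier L", OF _ subset_imp_lepoll] by simp
    then show ?thesis using X by blast
  qed
  have 4: "\<exists>L\<in>?B. \<exists>r. frame_rep L X r" if X: "X \<in> ?V" for X
  proof -
    obtain e where e: "inj_on e (Pow (topspace X))" "e ` Pow (topspace X) \<in> U"
      using pow X by blast
    have s: "{T. openin X T} \<subseteq> Pow (topspace X)" using openin_subset by blast
    obtain L :: "'u gorder" and r
      where L: "carrier L = e ` {T. openin X T}" "stone_frame L" "frame_rep L X r"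
      using ex_frame_of_space[OF _ inj_on_subset[OF e(1) s]] X by blast
    have "carrier L \<in> U"
      unfolding L(1) by (rule sub[OF e(2) subset_imp_lepoll[OF image_mono[OF s]]])
    then have "L \<in> ?B" using L(2) by simp
    with L(3) show ?thesis by blast
  qed
  have "?V \<subseteq> Collect stone_space" by blast
  note * = equivalent_mt_frm_top[OF this 1 2 3 4]
  have "StoneMT U = mt_cat ?A" "StoneFrm U = frm_cat ?B" "Stone U = top_cat ?V"
    by (simp_all add: StoneMT_def mt_cat_def StoneFrm_def frm_cat_def Stone_def top_cat_def)
  with * show "equivalent (StoneMT U) (StoneFrm U)" "dually_equivalent (StoneMT U) (Stone U)"
    by (simp_all only:)
next
  let ?A = "{M :: 'p set mt. stone_mt M \<and> mt_atoms M \<lesssim> (UNIV :: 'p set)}"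
  let ?B = "{L :: 'p set gorder. stone_frame L \<and> frm_points L \<lesssim> (UNIV :: 'p set)}"
  let ?V = "Collect stone_space :: 'p topology set"
  have 1: "\<exists>X\<in>?V. \<exists>r. mt_rep M X r" if M: "M \<in> ?A" for M
  proof -
    interpret stone_mt_alg M using M by (intro stone_mt_algI) simp
    \<comment> \<open>The algebra lives on \<open>'p set\<close> but its space has to live on
      \<open>'p\<close>; the bound on the atoms supplies the relabelling.\<close>
    obtain i :: "'p set \<Rightarrow> 'p" where "inj_on i (mt_atoms M)" using M unfolding lepoll_def by blast
    from ex_space[OF this] show ?thesis by blast
  qed
  have 2: "\<exists>M\<in>?A. \<exists>r. mt_rep M X r" if X: "X \<in> ?V" for X
  proof -
    obtain M :: "'p set mt" and r where M: "stone_mt M" "mt_rep M X r"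
      using ex_mt_of_space[of X id] X by auto
    have "mt_atoms M \<lesssim> (UNIV :: 'p set)"
      by (rule lepoll_trans[OF mt_rep.atoms_lepoll[OF M(2)] subset_imp_lepoll]) simp
    then show ?thesis using M by blast
  qed
  have 3: "\<exists>X\<in>?V. \<exists>r. frame_rep L X r" if L: "L \<in> ?B" for L
  proof -
    interpret stone_frm L using L by (intro stone_frmI) simp
    \<comment> \<open>The bound speaks of points, while the construction uses coatoms. An auxiliary
      space on the coatoms themselves shows that there are equally many of both; only then is the
      actual space built on \<open>'p\<close>.\<close>
    obtain X and r :: "'p set \<Rightarrow> 'p set set"
      where X: "topspace X = id ` frm_coatoms L" "stone_space X" "frame_rep L X r"
      using ex_space[OF inj_on_id] by blast
    have "frm_coatoms L \<approx> frm_points L"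
      using eqpoll_sym[OF frm_points_eqpoll[OF X(3) stone_space_Hausdorff[OF X(2)]]] X(1) by simp
    moreover have "frm_points L \<lesssim> (UNIV :: 'p set)" using L by blast
    ultimately have "frm_coatoms L \<lesssim> (UNIV :: 'p set)" by (rule lepoll_trans1)
    then obtain i :: "'p set \<Rightarrow> 'p" where "inj_on i (frm_coatoms L)" unfolding lepoll_def by blast
    from ex_space[OF this] show ?thesis by blast
  qed
  have 4: "\<exists>L\<in>?B. \<exists>r. frame_rep L X r" if X: "X \<in> ?V" for X
  proof -
    obtain L :: "'p set gorder" and r where L: "stone_frame L" "frame_rep L X r"
      using ex_frame_of_space[of X id] X by auto
    have "Hausdorff_space X" using X by (intro stone_space_Hausdorff) simp
    from lepoll_trans1[OF frm_points_eqpoll[OF L(2) this] subset_imp_lepoll[OF subset_UNIV]]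
    show ?thesis using L by blast
  qed
  note * = equivalent_mt_frm_top[OF subset_refl 1 2 3 4]
  have "StoneMT_upto TYPE('p) = mt_cat ?A" "StoneFrm_upto TYPE('p) = frm_cat ?B"
    "Stone (UNIV :: 'p set set) = top_cat ?V"
    by (simp_all add: StoneMT_upto_def StoneFrm_upto_def full_subcat_def
        StoneMT_def mt_cat_def StoneFrm_def frm_cat_def Stone_def top_cat_def)
  with * show "equivalent (StoneMT_upto TYPE('p)) (StoneFrm_upto TYPE('p))"
    "dually_equivalent (StoneMT_upto TYPE('p)) (Stone (UNIV :: 'p set set))"
    by (simp_all only:)
qed

end
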